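(* Let $m\ge 0$ and $n\ge 1$ be integers, and let $R$ be a field of characteristic either $0$ or a prime $p>\lceil m/2\rceil$. Let $E^m$ be the Grassmann algebra of rank $m$ over $R$. Let $\lambda_1,\dots,\lambda_n\in R$ be distinct elements, and let $v\in E^m$ be $$v=\sum_{j=1}^{\lfloor m/2\rfloor}v_{2j-1}v_{2j}\ \text{ if } m \text{ is even},\qquad v=\sum_{j=1}^{\lfloor m/2\rfloor}v_{2j-1}v_{2j}+v_m\ \text{ if } m \text{ is odd}.$$ Let $A=\operatorname{diag}(\lambda_i+v)_{i=1}^n\in M_nE^m$, so that the degree zero component of $A$ is $A_0=\operatorname{diag}(\lambda_i)_{i=1}^n$. Then the characteristic polynomial of $A_0$ is $$f(x)=\prod_{i=1}^n(x-\lambda_i),$$ and the minimal polynomial of $A$ over $R$ is $$f(x)^{\lceil m/2\rceil+1}.$$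
   Context: The Grassmann algebra of rank $m$ over $R$ is the $R$-algebra $E^m=R\langle v_1,\dots,v_m\rangle/(v_k^2,\ v_iv_j+v_jv_i\mid 1\le k\le m,\ 1\le i<j\le m)$. It is graded with each $v_i$ of degree $1$: $E^m=\bigoplus_{i=0}^m E^m_i$, $E^m_0=R$. For a set $X$, $M_nX$ denotes the set of $n\times n$ matrices with entries in $X$. Every $A\in M_nE^m$ decomposes uniquely as $A=\sum_{i=0}^m A_i$ with $A_i\in M_nE^m_i$; $A_0\in M_nR$ is the degree zero component. The minimal polynomial of $A$ over the field $R$ is the monic polynomial of least degree in $R[x]$ vanishing at $A$ (as an element of the $R$-algebra $M_nE^m$). *)

theory Defs
  imports
    "HOL-Library.Poly_Mapping"
    "HOL-Algebra.QuotRing"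
    "Jordan_Normal_Form.Char_Poly"
begin

section \<open>Free associative algebras\<close>

text \<open>
  Words get a type of their own, so that no monoid structure is imposed on the list type.
\<close>

datatype 'a word = Word (letters: "'a list")

instantiation word :: (type) monoid_add
begin

definition zero_word :: "'a word" where
  "0 = Word []"

definition plus_word :: "'a word \<Rightarrow> 'a word \<Rightarrow> 'a word" where
  "u + w = Word (letters u @ letters w)"

instance
  by standard (simp_all add: zero_word_def plus_word_def)

end

text \<open>
  Finitely supported functions from words to coefficients, with the convolution product of
  \<^theory>\<open>HOL-Library.Poly_Mapping\<close>, are the noncommutative polynomials. The carrier below
  consists of those in the variables with indices \<open>1, \<dots>, m\<close>.
\<close>

type_synonym 'a ncpoly = "nat word \<Rightarrow>\<^sub>0 'a"

definition free_algebra :: "nat \<Rightarrow> 'a::comm_ring_1 ncpoly ring" where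
  "free_algebra m =
    \<lparr>carrier = {p. \<forall>w \<in> Poly_Mapping.keys p. set (letters w) \<subseteq> {1..m}},
     monoid.mult = (*), one = 1, zero = 0, add = (+)\<rparr>"

definition var :: "nat \<Rightarrow> 'a::comm_ring_1 ncpoly" where
  "var i = Poly_Mapping.single (Word [i]) 1"

definition const :: "'a \<Rightarrow> 'a::comm_ring_1 ncpoly" where
  "const c = Poly_Mapping.single 0 c"

lemma ring_free_algebra: "ring (free_algebra m :: 'a::comm_ring_1 ncpoly ring)"
proof (rule ringI)
  let ?F = "free_algebra m :: 'a ncpoly ring"
  have neg: "- p \<in> carrier ?F" if "p \<in> carrier ?F" for p
    using that by (simp add: free_algebra_def)
  have add: "p + q \<in> carrier ?F" if "p \<in> carrier ?F" "q \<in> carrier ?F" for p q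
    using that Poly_Mapping.keys_add[of p q] unfolding free_algebra_def by auto
  have mult: "p * q \<in> carrier ?F" if "p \<in> carrier ?F" "q \<in> carrier ?F" for p q
    using that keys_mult[of p q] unfolding free_algebra_def plus_word_def by fastforce
  show "abelian_group ?F"
  proof (rule abelian_groupI)
    show "\<exists>q \<in> carrier ?F. q \<oplus>\<^bsub>?F\<^esub> p = \<zero>\<^bsub>?F\<^esub>" if "p \<in> carrier ?F" for p
      using neg[OF that] by (intro bexI[of _ "- p"]) (simp_all add: free_algebra_def)
    show "p \<oplus>\<^bsub>?F\<^esub> q \<in> carrier ?F" if "p \<in> carrier ?F" "q \<in> carrier ?F" for p q
      using add[OF that] by (simp add: free_algebra_def)
  qed (simp_all add: free_algebra_def add_ac)
  show "monoid ?F"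
  proof (rule monoidI)
    show "p \<otimes>\<^bsub>?F\<^esub> q \<in> carrier ?F" if "p \<in> carrier ?F" "q \<in> carrier ?F" for p q
      using mult[OF that] by (simp add: free_algebra_def)
    show "\<one>\<^bsub>?F\<^esub> \<in> carrier ?F"
      by (simp add: free_algebra_def zero_word_def)
  qed (simp_all add: free_algebra_def mult.assoc)
qed (simp_all add: free_algebra_def algebra_simps)


section \<open>The Grassmann algebra\<close>

definition grassmann_relations :: "nat \<Rightarrow> 'a::comm_ring_1 ncpoly set" where
  "grassmann_relations m =
    {var k * var k | k. 1 \<le> k \<and> k \<le> m} \<union>
    {var i * var j + var j * var i | i j. 1 \<le> i \<and> i < j \<and> j \<le> m}"

definition grassmann_ideal :: "nat \<Rightarrow> 'a::comm_ring_1 ncpoly set" where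
  "grassmann_ideal m = Idl\<^bsub>free_algebra m\<^esub> (grassmann_relations m)"

definition grassmann :: "nat \<Rightarrow> 'a::comm_ring_1 ncpoly set ring" where
  "grassmann m = free_algebra m Quot grassmann_ideal m"

definition grassmann_class :: "nat \<Rightarrow> 'a::comm_ring_1 ncpoly \<Rightarrow> 'a ncpoly set" where
  "grassmann_class m p = grassmann_ideal m +>\<^bsub>free_algebra m\<^esub> p"

definition grassmann_gen :: "nat \<Rightarrow> nat \<Rightarrow> 'a::comm_ring_1 ncpoly set" where
  "grassmann_gen m i = grassmann_class m (var i)"

text \<open>The structure map of the algebra, which identifies the coefficients with degree \<open>0\<close>.\<close>

definition grassmann_scalar :: "nat \<Rightarrow> 'a \<Rightarrow> 'a::comm_ring_1 ncpoly set" where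
  "grassmann_scalar m c = grassmann_class m (const c)"

definition grassmann_degree :: "nat \<Rightarrow> nat \<Rightarrow> 'a::comm_ring_1 ncpoly set set" where
  "grassmann_degree m d = grassmann_class m `
    {p \<in> carrier (free_algebra m). \<forall>w \<in> Poly_Mapping.keys p. length (letters w) = d}"

lemma ideal_grassmann_ideal:
  "ideal (grassmann_ideal m :: 'a::comm_ring_1 ncpoly set) (free_algebra m)"
proof -
  interpret F: ring "free_algebra m :: 'a ncpoly ring"
    by (rule ring_free_algebra)
  have var: "var i \<in> carrier (free_algebra m :: 'a ncpoly ring)" if "1 \<le> i" "i \<le> m" for i
    using that by (simp add: free_algebra_def var_def)
  have mult: "x * y \<in> carrier (free_algebra m)"
    if "x \<in> carrier (free_algebra m)" "y \<in> carrier (free_algebra m)" for x y :: "'a ncpoly"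
    using F.m_closed[OF that] by (simp add: free_algebra_def)
  have add: "x + y \<in> carrier (free_algebra m)"
    if "x \<in> carrier (free_algebra m)" "y \<in> carrier (free_algebra m)" for x y :: "'a ncpoly"
    using F.a_closed[OF that] by (simp add: free_algebra_def)
  have "(grassmann_relations m :: 'a ncpoly set) \<subseteq> carrier (free_algebra m)"
  proof
    fix x :: "'a ncpoly"
    assume "x \<in> grassmann_relations m"
    then consider
        k where "x = var k * var k" "1 \<le> k" "k \<le> m"
      | i j where "x = var i * var j + var j * var i" "1 \<le> i" "i < j" "j \<le> m"
      unfolding grassmann_relations_def by blast
    then show "x \<in> carrier (free_algebra m)"
    proof cases
      case 1
      then show ?thesis by (simp only: mult var)
    next
      case 2
      then have "1 \<le> j" "i \<le> m" by linarith+
      with 2 show ?thesis by (simp only: mult add var)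
    qed
  qed
  then show ?thesis
    unfolding grassmann_ideal_def by (rule F.genideal_ideal)
qed

lemma ring_grassmann: "ring (grassmann m :: 'a::comm_ring_1 ncpoly set ring)"
  unfolding grassmann_def by (rule ideal.quotient_is_ring[OF ideal_grassmann_ideal])


section \<open>Matrices over a ring given by a carrier\<close>

definition mat_over :: "nat \<Rightarrow> 'b set \<Rightarrow> 'b mat set" where
  "mat_over n X = {A \<in> carrier_mat n n. \<forall>i<n. \<forall>j<n. A $$ (i, j) \<in> X}"

definition diag_over :: "('b, 'c) ring_scheme \<Rightarrow> nat \<Rightarrow> (nat \<Rightarrow> 'b) \<Rightarrow> 'b mat" where
  "diag_over E n d = mat n n (\<lambda>(i, j). if i = j then d i else \<zero>\<^bsub>E\<^esub>)"

definition matrix_ring :: "('b, 'c) ring_scheme \<Rightarrow> nat \<Rightarrow> 'b mat ring" where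
  "matrix_ring E n =
    \<lparr>carrier = mat_over n (carrier E),
     monoid.mult = (\<lambda>A B. mat n n (\<lambda>(i, j). \<Oplus>\<^bsub>E\<^esub>k\<in>{..<n}. A $$ (i, k) \<otimes>\<^bsub>E\<^esub> B $$ (k, j))),
     one = diag_over E n (\<lambda>i. \<one>\<^bsub>E\<^esub>),
     zero = mat n n (\<lambda>(i, j). \<zero>\<^bsub>E\<^esub>),
     add = (\<lambda>A B. mat n n (\<lambda>(i, j). A $$ (i, j) \<oplus>\<^bsub>E\<^esub> B $$ (i, j)))\<rparr>"

definition grassmann_decomposition ::
    "nat \<Rightarrow> nat \<Rightarrow> 'a::comm_ring_1 ncpoly set mat \<Rightarrow> (nat \<Rightarrow> 'a ncpoly set mat) \<Rightarrow> bool" where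
  "grassmann_decomposition m n A C \<longleftrightarrow>
    (\<forall>i\<le>m. C i \<in> mat_over n (grassmann_degree m i)) \<and>
    A = (\<Oplus>\<^bsub>matrix_ring (grassmann m) n\<^esub>i\<in>{..m}. C i)"

text \<open>
  \<open>B\<close> is the degree \<open>d\<close> component of \<open>A\<close>: a decomposition of \<open>A\<close> exists, and \<open>B\<close> is the
  degree \<open>d\<close> term in each one.
\<close>

definition is_grassmann_component ::
    "nat \<Rightarrow> nat \<Rightarrow> 'a::comm_ring_1 ncpoly set mat \<Rightarrow> nat \<Rightarrow> 'a ncpoly set mat \<Rightarrow> bool" where
  "is_grassmann_component m n A d B \<longleftrightarrow>
    (\<exists>C. grassmann_decomposition m n A C) \<and>
    (\<forall>C. grassmann_decomposition m n A C \<longrightarrow> C d = B)"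


section \<open>Minimal polynomials\<close>

text \<open>
  An algebra \<open>S\<close> over the coefficient field is given by its structure map \<open>\<phi>\<close>, so that
  \<open>\<phi> c \<otimes> y\<close> is the scalar multiple of \<open>y\<close> by \<open>c\<close>.
\<close>

definition eval_in ::
    "('b, 'c) ring_scheme \<Rightarrow> ('a \<Rightarrow> 'b) \<Rightarrow> 'a::comm_ring_1 poly \<Rightarrow> 'b \<Rightarrow> 'b" where
  "eval_in S \<phi> p x =
    (\<Oplus>\<^bsub>S\<^esub>i\<in>{..degree p}. \<phi> (coeff p i) \<otimes>\<^bsub>S\<^esub> (x [^]\<^bsub>S\<^esub> i))"

definition is_min_poly ::
    "('b, 'c) ring_scheme \<Rightarrow> ('a \<Rightarrow> 'b) \<Rightarrow> 'b \<Rightarrow> 'a::field poly \<Rightarrow> bool" where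
  "is_min_poly S \<phi> x p \<longleftrightarrow>
    lead_coeff p = 1 \<and> eval_in S \<phi> p x = \<zero>\<^bsub>S\<^esub> \<and>
    (\<forall>q. lead_coeff q = 1 \<and> eval_in S \<phi> q x = \<zero>\<^bsub>S\<^esub> \<longrightarrow> degree p \<le> degree q)"

definition grassmann_scalar_mat :: "nat \<Rightarrow> nat \<Rightarrow> 'a \<Rightarrow> 'a::comm_ring_1 ncpoly set mat" where
  "grassmann_scalar_mat m n c = diag_over (grassmann m) n (\<lambda>i. grassmann_scalar m c)"

end

theory Submission
  imports Defs
begin

text \<open>
  The \<open>\<lceil>m/2\<rceil>\<close> summands of \<open>v\<close> commute pairwise and have square zero, so with \<open>c = \<lceil>m/2\<rceil>\<close> we get
  \<open>v\<^sup>c\<^sup>+\<^sup>1 = 0\<close> and \<open>v\<^sup>c = c! v\<^sub>1 \<dots> v\<^sub>m\<close>, which is nonzero by the assumption on the characteristic.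
  Hence \<open>q(a + v) = 0\<close> if and only if \<open>(x - a)\<^sup>c\<^sup>+\<^sup>1\<close> divides \<open>q\<close>. As \<open>q(A)\<close> is the diagonal matrix
  with entries \<open>q(\<lambda>\<^sub>i + v)\<close> and the \<open>\<lambda>\<^sub>i\<close> are distinct, \<open>q\<close> vanishes at \<open>A\<close> if and only if
  \<open>f\<^sup>c\<^sup>+\<^sup>1\<close> divides \<open>q\<close>.

  That \<open>v\<^sub>1 \<dots> v\<^sub>m \<noteq> 0\<close> is seen by a linear functional on the free algebra that vanishes on the
  Grassmann ideal: it sends a word \<open>w\<^sub>1 \<dots> w\<^sub>k\<close> to \<open>\<Prod>\<^sub>i\<^sub><\<^sub>j sgn (w\<^sub>j - w\<^sub>i)\<close>. Likewise the coefficient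
  of the empty word vanishes on the ideal, and it singles out the degree \<open>0\<close> component.
\<close>

section \<open>Evaluation of polynomials in algebras\<close>

text \<open>An algebra over \<open>'a\<close> is encoded as a ring with a structure map whose values
  are central. The Grassmann algebra is the instance used below; evaluation in the matrix ring is
  reduced to it entry by entry.\<close>

locale algebra_structure = ring S for S (structure) +
  fixes \<phi> :: "'a::comm_ring_1 \<Rightarrow> 'b"
  assumes scalar_closed [simp]: "\<phi> a \<in> carrier S"
    and scalar_1 [simp]: "\<phi> 1 = \<one>"
    and scalar_add: "\<phi> (a + b) = \<phi> a \<oplus> \<phi> b"
    and scalar_mult: "\<phi> (a * b) = \<phi> a \<otimes> \<phi> b"
    and scalar_comm: "x \<in> carrier S \<Longrightarrow> \<phi> a \<otimes> x = x \<otimes> \<phi> a"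
begin

lemma scalar_0 [simp]: "\<phi> 0 = \<zero>"
  using scalar_add[of 0 0] by (metis add.l_cancel_one add_0 scalar_closed)

lemma scalar_minus: "\<phi> (- a) = \<ominus> \<phi> a"
  using scalar_add[of "- a" a] by (intro minus_equality[symmetric]) simp_all

lemma eval_in_closed [simp]: "x \<in> carrier S \<Longrightarrow> eval_in S \<phi> p x \<in> carrier S"
  unfolding eval_in_def by (intro finsum_closed) auto

text \<open>Coefficients above the degree vanish, so the summation bound may be raised. This spares
  \<open>eval_in_pCons\<close> a case distinction at \<open>p = 0\<close>, where
  \<open>pCons\<close> does not raise the degree.\<close>

lemma eval_in_eq:
  assumes "degree p \<le> N" "x \<in> carrier S"
  shows "eval_in S \<phi> p x = (\<Oplus>i\<in>{..N}. \<phi> (coeff p i) \<otimes> x [^] i)"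
  unfolding eval_in_def
  using assms
  by (intro add.finprod_mono_neutral_cong_left) (auto simp: coeff_eq_0)

lemma eval_in_0 [simp]: "x \<in> carrier S \<Longrightarrow> eval_in S \<phi> 0 x = \<zero>"
  by (simp add: eval_in_def)

text \<open>This is Horner's rule: centrality of the scalars lets one factor \<open>x\<close> be
  pulled out of every term but the constant one. The evaluation laws for sums, scalar multiples and
  products follow from it by induction over \<open>pCons\<close>.\<close>

lemma eval_in_pCons:
  assumes x: "x \<in> carrier S"
  shows "eval_in S \<phi> (pCons a p) x = \<phi> a \<oplus> x \<otimes> eval_in S \<phi> p x"
proof -
  let ?N = "degree p"
  have "eval_in S \<phi> (pCons a p) x = (\<Oplus>i\<in>{..Suc ?N}. \<phi> (coeff (pCons a p) i) \<otimes> x [^] i)"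
    using x by (intro eval_in_eq) (simp_all add: degree_pCons_le)
  also have "\<dots> = (\<Oplus>i\<in>{..?N}. \<phi> (coeff p i) \<otimes> x [^] Suc i) \<oplus> \<phi> a"
    using x by (subst add.finprod_Suc2) auto
  also have "(\<Oplus>i\<in>{..?N}. \<phi> (coeff p i) \<otimes> x [^] Suc i)
      = (\<Oplus>i\<in>{..?N}. x \<otimes> (\<phi> (coeff p i) \<otimes> x [^] i))"
  proof (intro add.finprod_cong' refl)
    fix i
    have "\<phi> (coeff p i) \<otimes> x [^] Suc i = \<phi> (coeff p i) \<otimes> (x \<otimes> x [^] i)"
      using x by (simp only: nat_pow_Suc2)
    also have "\<dots> = x \<otimes> (\<phi> (coeff p i) \<otimes> x [^] i)"
      using x scalar_comm[of x "coeff p i"] by (simp flip: m_assoc)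
    finally show "\<phi> (coeff p i) \<otimes> x [^] Suc i = x \<otimes> (\<phi> (coeff p i) \<otimes> x [^] i)" .
  qed (use x in auto)
  also have "\<dots> = x \<otimes> eval_in S \<phi> p x"
    unfolding eval_in_def using x by (intro finsum_rdistr[symmetric]) auto
  finally show ?thesis using x by (simp add: a_comm)
qed

lemma eval_in_const [simp]: "x \<in> carrier S \<Longrightarrow> eval_in S \<phi> [:a:] x = \<phi> a"
  by (simp add: eval_in_pCons)

lemma eval_in_1 [simp]: "x \<in> carrier S \<Longrightarrow> eval_in S \<phi> 1 x = \<one>"
  using eval_in_const[of x 1] by (simp only: scalar_1 one_pCons)

lemma eval_in_add:
  assumes "x \<in> carrier S"
  shows "eval_in S \<phi> (p + q) x = eval_in S \<phi> p x \<oplus> eval_in S \<phi> q x"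
proof (induction p q rule: poly_induct2)
  case (pCons a p b q)
  then show ?case using assms by (simp add: eval_in_pCons scalar_add r_distr a_ac)
qed (use assms in simp)

lemma eval_in_smult:
  assumes "x \<in> carrier S"
  shows "eval_in S \<phi> (Polynomial.smult a p) x = \<phi> a \<otimes> eval_in S \<phi> p x"
proof (induction p)
  case (pCons b p)
  then show ?case
    using assms scalar_comm[of x a]
    by (simp add: eval_in_pCons scalar_mult r_distr flip: m_assoc)
qed (use assms in simp)

lemma eval_in_mult:
  assumes "x \<in> carrier S"
  shows "eval_in S \<phi> (p * q) x = eval_in S \<phi> p x \<otimes> eval_in S \<phi> q x"
proof (induction p)
  case (pCons a p)
  then show ?case
    using assms by (simp add: eval_in_pCons eval_in_add eval_in_smult l_distr m_assoc)
qed (use assms in simp)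

lemma eval_in_power:
  assumes "x \<in> carrier S"
  shows "eval_in S \<phi> (p ^ k) x = eval_in S \<phi> p x [^] k"
proof (induction k)
  case (Suc k)
  have "eval_in S \<phi> (p ^ Suc k) x = eval_in S \<phi> (p ^ k * p) x"
    by (simp only: power_Suc2)
  then show ?case using assms Suc by (simp add: eval_in_mult)
qed (use assms in simp)

text \<open>Substituting \<open>\<phi> a \<oplus> y\<close> turns the polynomial x - a into
  \<open>y\<close>, so powers of this linear factor evaluate to powers of \<open>y\<close>.\<close>

lemma eval_in_linear_power:
  assumes "y \<in> carrier S"
  shows "eval_in S \<phi> ([:- a, 1:] ^ k) (\<phi> a \<oplus> y) = y [^] k"
proof -
  have "eval_in S \<phi> [:- a, 1:] (\<phi> a \<oplus> y) = \<ominus> \<phi> a \<oplus> (\<phi> a \<oplus> y)"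
    using assms by (simp add: eval_in_pCons scalar_minus)
  also have "\<dots> = y"
    using assms by (simp flip: a_assoc add: l_neg)
  finally show ?thesis using assms by (simp add: eval_in_power)
qed

section \<open>Powers of sums of commuting elements with square zero\<close>

text \<open>In the binomial expansion every term containing \<open>x\<close> twice vanishes, which
  leaves two terms. The exponent is a successor so that \<open>r\<close> itself can be the exponent
  of the mixed term.\<close>

lemma add_square_zero_power:
  assumes y: "y \<in> carrier S" and x: "x \<in> carrier S"
    and comm: "x \<otimes> y = y \<otimes> x" and sq: "x \<otimes> x = \<zero>"
  shows "(y \<oplus> x) [^] Suc r = y [^] Suc r \<oplus> \<phi> (of_nat (Suc r)) \<otimes> (y [^] r \<otimes> x)"
proof (induction r)
  case 0
  then show ?case using x y by simp
next
  case (Suc r)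
  let ?c = "\<phi> (of_nat (Suc r))"
  have pow: "y [^] r \<otimes> x \<otimes> y = y [^] Suc r \<otimes> x"
    using x y comm by (simp add: m_assoc)
  have "(y \<oplus> x) [^] Suc (Suc r)
      = (y [^] Suc r \<oplus> ?c \<otimes> (y [^] r \<otimes> x)) \<otimes> (y \<oplus> x)"
    using Suc by (simp only: nat_pow_Suc)
  also have "\<dots> = y [^] Suc r \<otimes> y \<oplus> y [^] Suc r \<otimes> x
      \<oplus> (?c \<otimes> (y [^] r \<otimes> x \<otimes> y) \<oplus> ?c \<otimes> (y [^] r \<otimes> (x \<otimes> x)))"
    using x y by (simp add: l_distr r_distr m_assoc del: nat_pow_Suc of_nat_Suc)
      (simp add: a_ac)
  also have "\<dots> = y [^] Suc (Suc r) \<oplus> (y [^] Suc r \<otimes> x \<oplus> ?c \<otimes> (y [^] Suc r \<otimes> x))"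
    unfolding pow sq using x y by (simp add: a_assoc)
  also have "y [^] Suc r \<otimes> x \<oplus> ?c \<otimes> (y [^] Suc r \<otimes> x) = (\<one> \<oplus> ?c) \<otimes> (y [^] Suc r \<otimes> x)"
    using x y by (simp add: l_distr del: nat_pow_Suc)
  also have "\<one> \<oplus> ?c = \<phi> (of_nat (Suc (Suc r)))"
    using scalar_add[of 1 "of_nat (Suc r)"] by simp
  finally show ?case .
qed

text \<open>In a power of the sum only products of distinct summands survive. With exponent
  \<open>Suc K\<close> there are none; with exponent \<open>K\<close> the full product remains, once
  for each of the K! orders. That product enters through its recursion \<open>P\<close>, so that it
  can later be an explicit monomial class.\<close>

lemma sum_square_zero_power:
  assumes x: "\<And>j. j \<in> {1..K} \<Longrightarrow> x j \<in> carrier S"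
    and sq: "\<And>j. j \<in> {1..K} \<Longrightarrow> x j \<otimes> x j = \<zero>"
    and comm: "\<And>i j. i \<in> {1..K} \<Longrightarrow> j \<in> {1..K} \<Longrightarrow> x i \<otimes> x j = x j \<otimes> x i"
    and P0: "P 0 = \<one>"
    and PSuc: "\<And>k. k < K \<Longrightarrow> P (Suc k) = P k \<otimes> x (Suc k)"
  shows "(\<Oplus>j\<in>{1..K}. x j) [^] Suc K = \<zero>"
    and "(\<Oplus>j\<in>{1..K}. x j) [^] K = \<phi> (of_nat (fact K)) \<otimes> P K"
proof -
  define y where "y k = (\<Oplus>j\<in>{1..k}. x j)" for k
  have y: "y k \<in> carrier S" if "k \<le> K" for k
    unfolding y_def using that by (intro finsum_closed) (auto intro!: x)
  have P: "P k \<in> carrier S" if "k \<le> K" for k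
    using that by (induction k) (auto simp: P0 PSuc intro!: x)
  \<comment> \<open>The two claims go together: when \<open>y k \<oplus> x (Suc k)\<close> is
    expanded, the vanishing of \<open>y k [^] Suc k\<close> removes the pure power from one
    expansion and both terms from the other.\<close>
  have "y k [^] Suc k = \<zero> \<and> y k [^] k = \<phi> (of_nat (fact k)) \<otimes> P k" if "k \<le> K" for k
    using that
  proof (induction k)
    case 0
    then show ?case by (simp add: y_def P0)
  next
    case (Suc k)
    let ?x = "x (Suc k)"
    have k: "k \<le> K" and IH1: "y k [^] Suc k = \<zero>" and IH2: "y k [^] k = \<phi> (of_nat (fact k)) \<otimes> P k"
      using Suc by auto
    have xS: "?x \<in> carrier S" using Suc.prems by (intro x) auto
    have yS: "y (Suc k) = y k \<oplus> ?x"
    proof -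
      have "{1..Suc k} = insert (Suc k) {1..k}" by auto
      then have "y (Suc k) = ?x \<oplus> y k"
        unfolding y_def using Suc.prems xS
        by (simp del: finsum_insert) (subst finsum_insert; auto intro!: x)
      then show ?thesis using xS y[OF k] by (simp add: a_comm)
    qed
    have yc: "?x \<otimes> y k = y k \<otimes> ?x"
    proof -
      have xj: "x j \<in> carrier S" if "j \<in> {1..k}" for j
        using that k by (intro x) auto
      have "?x \<otimes> y k = (\<Oplus>j\<in>{1..k}. ?x \<otimes> x j)"
        unfolding y_def using xS xj by (intro finsum_rdistr) auto
      also have "\<dots> = (\<Oplus>j\<in>{1..k}. x j \<otimes> ?x)"
        using Suc.prems xS xj by (intro add.finprod_cong' refl comm) auto
      also have "\<dots> = y k \<otimes> ?x"
        unfolding y_def using xS xj by (intro finsum_ldistr[symmetric]) auto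
      finally show ?thesis .
    qed
    have xx: "?x \<otimes> ?x = \<zero>" using Suc.prems by (intro sq) auto
    note expand = add_square_zero_power[OF y[OF k] xS yc xx]
    have "y (Suc k) [^] Suc k = \<phi> (of_nat (Suc k)) \<otimes> (y k [^] k \<otimes> ?x)"
      unfolding yS expand IH1 using y[OF k] xS by simp
    also have "\<dots> = \<phi> (of_nat (fact (Suc k))) \<otimes> P (Suc k)"
      unfolding IH2 using Suc.prems xS P[OF k]
      by (simp add: PSuc m_assoc fact_Suc scalar_mult del: of_nat_Suc mult_Suc)
    finally have 1: "y (Suc k) [^] Suc k = \<phi> (of_nat (fact (Suc k))) \<otimes> P (Suc k)" .
    have "y k [^] Suc (Suc k) = \<zero>"
      using IH1 y[OF k] by (subst nat_pow_Suc) (simp only: l_null)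
    then have "y (Suc k) [^] Suc (Suc k) = \<zero>"
      unfolding yS expand[of "Suc k"] IH1 using y[OF k] xS by simp
    with 1 show ?case by blast
  qed
  from this[OF order_refl] show "(\<Oplus>j\<in>{1..K}. x j) [^] Suc K = \<zero>"
    "(\<Oplus>j\<in>{1..K}. x j) [^] K = \<phi> (of_nat (fact K)) \<otimes> P K"
    unfolding y_def by blast+
qed

end

section \<open>Evaluation at a scalar plus a nilpotent element\<close>

locale field_algebra_structure = algebra_structure S \<phi>
  for S (structure) and \<phi> :: "'a::field \<Rightarrow> 'b"
begin

lemma scalar_mult_eq_0_iff:
  assumes "y \<in> carrier S" "a \<noteq> 0"
  shows "\<phi> a \<otimes> y = \<zero> \<longleftrightarrow> y = \<zero>"
proof
  assume "\<phi> a \<otimes> y = \<zero>"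
  then have "\<phi> (inverse a) \<otimes> (\<phi> a \<otimes> y) = \<zero>" by simp
  then have "\<phi> (inverse a * a) \<otimes> y = \<zero>"
    using assms by (simp only: scalar_mult m_assoc scalar_closed)
  then show "y = \<zero>" using assms by simp
qed simp

text \<open>Split off the exact power of x - a, so that q = (x - a)^k r with r(a) nonzero. If k
  \<le> c, multiplying q(a + y) by y^(c - k) leaves r(a) y^c, which is nonzero; hence a root forces
  k > c.\<close>

lemma eval_in_nilpotent_eq_0_iff:
  assumes y: "y \<in> carrier S" and pow0: "y [^] Suc c = \<zero>" and pow: "y [^] c \<noteq> \<zero>"
  shows "eval_in S \<phi> q (\<phi> a \<oplus> y) = \<zero> \<longleftrightarrow> [:- a, 1:] ^ Suc c dvd q"
proof
  assume "[:- a, 1:] ^ Suc c dvd q"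
  then obtain r where "q = [:- a, 1:] ^ Suc c * r" by (elim dvdE)
  then show "eval_in S \<phi> q (\<phi> a \<oplus> y) = \<zero>"
    using y pow0 by (simp only: eval_in_mult eval_in_linear_power a_closed scalar_closed) simp
next
  let ?x = "\<phi> a \<oplus> y"
  have x: "?x \<in> carrier S" using y by simp
  assume 0: "eval_in S \<phi> q ?x = \<zero>"
  show "[:- a, 1:] ^ Suc c dvd q"
  proof (cases "q = 0")
    case False
    define k where "k = Polynomial.order a q"
    obtain r where q: "q = [:- a, 1:] ^ k * r" and ndvd: "\<not> [:- a, 1:] dvd r"
      using order_decomp[OF False, of a] unfolding k_def by blast
    show ?thesis
    proof (rule ccontr)
      assume "\<not> ?thesis"
      then have k: "k \<le> c"
        using False order_divides[of a "Suc c" q] unfolding k_def by simp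
      \<comment> \<open>Division by x - a leaves the remainder r(a), and the quotient
        \<open>s\<close> enters the value at \<open>?x\<close> only with a factor
        \<open>y\<close>.\<close>
      obtain s where "r - [:poly r a:] = [:- a, 1:] * s"
        using poly_eq_0_iff_dvd[of "r - [:poly r a:]" a] by (auto elim: dvdE)
      then have r: "r = [:poly r a:] + [:- a, 1:] ^ 1 * s"
        by (simp add: algebra_simps)
      have ra: "poly r a \<noteq> 0" using ndvd by (simp add: poly_eq_0_iff_dvd)
      have evs: "eval_in S \<phi> s ?x \<in> carrier S" using x by simp
      have evr: "eval_in S \<phi> r ?x = \<phi> (poly r a) \<oplus> y \<otimes> eval_in S \<phi> s ?x"
        using y eval_in_linear_power[OF y, of a 1]
        by (subst r) (simp only: eval_in_add eval_in_mult eval_in_const x, simp)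
      have "y [^] k \<otimes> eval_in S \<phi> r ?x = \<zero>"
        using 0 y unfolding q by (simp add: eval_in_mult eval_in_linear_power)
      \<comment> \<open>Raising the exponent to exactly \<open>c\<close> gives the term of
        \<open>s\<close> the factor \<open>y [^] Suc c = \<zero>\<close>, while the term of the
        constant r(a) keeps \<open>y [^] c\<close>.\<close>
      then have "y [^] (c - k) \<otimes> (y [^] k \<otimes> eval_in S \<phi> r ?x) = \<zero>"
        using y by simp
      then have "y [^] c \<otimes> eval_in S \<phi> r ?x = \<zero>"
        using y k by (simp add: nat_pow_mult flip: m_assoc)
      then have "y [^] c \<otimes> \<phi> (poly r a) \<oplus> y [^] Suc c \<otimes> eval_in S \<phi> s ?x = \<zero>"
        unfolding evr using y evs by (simp add: r_distr m_assoc)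
      then have "\<phi> (poly r a) \<otimes> y [^] c = \<zero>"
        unfolding pow0 using y evs by (simp add: scalar_comm)
      with pow ra y show False by (simp add: scalar_mult_eq_0_iff)
    qed
  qed simp
qed

end


section \<open>Functionals on the Grassmann algebra\<close>

lemma poly_mapping_induct_single [case_names zero add single]:
  fixes p :: "'k \<Rightarrow>\<^sub>0 'a::comm_monoid_add"
  assumes "P 0" and "\<And>p q. P p \<Longrightarrow> P q \<Longrightarrow> P (p + q)"
    and "\<And>k c. P (Poly_Mapping.single k c)"
  shows "P p"
proof (induction p rule: update_induct)
  case (update f a b)
  have "Poly_Mapping.update a b f = f + Poly_Mapping.single a b"
    using update(1)
    by (intro poly_mapping_eqI)
      (auto simp: lookup_update lookup_add lookup_single when_def in_keys_iff)
  with update assms show ?case by simp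
qed (rule assms(1))

definition word_functional :: "(nat word \<Rightarrow> 'a) \<Rightarrow> 'a::comm_ring_1 ncpoly \<Rightarrow> 'a" where
  "word_functional s p = (\<Sum>w\<in>Poly_Mapping.keys p. Poly_Mapping.lookup p w * s w)"

lemma word_functional_eq:
  assumes "finite K" "Poly_Mapping.keys p \<subseteq> K"
  shows "word_functional s p = (\<Sum>w\<in>K. Poly_Mapping.lookup p w * s w)"
  unfolding word_functional_def
  using assms by (intro sum.mono_neutral_left) (auto simp: in_keys_iff)

lemma word_functional_add: "word_functional s (p + q) = word_functional s p + word_functional s q"
proof -
  let ?K = "Poly_Mapping.keys p \<union> Poly_Mapping.keys q"
  have "word_functional s r = (\<Sum>w\<in>?K. Poly_Mapping.lookup r w * s w)" if "r \<in> {p, q, p + q}" for r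
    using that Poly_Mapping.keys_add[of p q] by (intro word_functional_eq) auto
  then show ?thesis by (simp add: lookup_add distrib_right sum.distrib)
qed

lemma word_functional_single [simp]: "word_functional s (Poly_Mapping.single w c) = c * s w"
  by (simp add: word_functional_def)

lemma word_functional_0 [simp]: "word_functional s 0 = 0"
  by (simp add: word_functional_def)

lemma word_functional_minus: "word_functional s (- p) = - word_functional s p"
  using word_functional_add[of s "- p" p] by (simp add: eq_neg_iff_add_eq_0)

text \<open>These conditions make the linear extension of \<open>s\<close> vanish on every relation
  multiplied by words on both sides. The first clause stands separately because in characteristic 2
  it does not follow from the second.\<close>

definition alternating :: "(nat word \<Rightarrow> 'a::comm_ring_1) \<Rightarrow> bool" where
  "alternating s \<longleftrightarrow>
    (\<forall>u w k. s (u + Word [k, k] + w) = 0) \<and>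
    (\<forall>u w i j. s (u + Word [i, j] + w) = - s (u + Word [j, i] + w))"

lemma free_algebra_simps [simp]:
  "x \<oplus>\<^bsub>free_algebra m\<^esub> y = x + y" "x \<otimes>\<^bsub>free_algebra m\<^esub> y = x * y"
  "\<zero>\<^bsub>free_algebra m\<^esub> = 0" "\<one>\<^bsub>free_algebra m\<^esub> = 1"
  by (simp_all add: free_algebra_def)

lemma free_algebra_minus [simp]:
  assumes "x \<in> carrier (free_algebra m)"
  shows "\<ominus>\<^bsub>free_algebra m\<^esub> x = - (x :: 'a::comm_ring_1 ncpoly)"
proof -
  interpret F: ring "free_algebra m :: 'a ncpoly ring" by (rule ring_free_algebra)
  have "- x \<in> carrier (free_algebra m)" using assms by (simp add: free_algebra_def)
  then show ?thesis using assms by (intro F.minus_equality[of "- x" x]) simp_all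
qed

lemma single_in_free_algebra [simp]:
  "set xs \<subseteq> {1..m} \<Longrightarrow> Poly_Mapping.single (Word xs) c \<in> carrier (free_algebra m)"
  by (auto simp: free_algebra_def)

lemma var_in_free_algebra [simp]: "i \<in> {1..m} \<Longrightarrow> var i \<in> carrier (free_algebra m)"
  by (simp add: var_def)

lemma const_in_free_algebra [simp]: "const c \<in> carrier (free_algebra m)"
  by (simp add: const_def zero_word_def)

text \<open>The elements all of whose two-sided multiples are killed by the functional form an
  ideal. It contains the relations, hence the ideal they generate.\<close>

lemma word_functional_grassmann_ideal:
  fixes p :: "'a::comm_ring_1 ncpoly"
  assumes alt: "alternating s" and p: "p \<in> grassmann_ideal m"
  shows "word_functional s p = 0"
proof -
  let ?F = "free_algebra m :: 'a ncpoly ring"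
  interpret F: ring ?F by (rule ring_free_algebra)
  \<comment> \<open>The multipliers \<open>a\<close> and \<open>b\<close> make this an ideal; the
    kernel of the functional alone need not be closed under products.\<close>
  define K where "K = {p \<in> carrier ?F. \<forall>a b. word_functional s (a * p * b) = 0}"
  have "ideal K ?F"
  proof (rule idealI)
    show "subgroup K (add_monoid ?F)"
    proof (rule F.add.subgroupI)
      show "\<ominus>\<^bsub>?F\<^esub> x \<in> K" if "x \<in> K" for x
        using that F.a_inv_closed[of x] unfolding K_def
        by (auto simp: word_functional_minus)
      show "x \<oplus>\<^bsub>?F\<^esub> y \<in> K" if "x \<in> K" "y \<in> K" for x y
        using that F.a_closed[of x y] unfolding K_def
        by (auto simp: word_functional_add algebra_simps)
      have "0 \<in> K" using F.zero_closed by (simp add: K_def)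
      then show "K \<noteq> {}" by blast
    qed (auto simp: K_def)
    show "x \<otimes>\<^bsub>?F\<^esub> a \<in> K" if "a \<in> K" "x \<in> carrier ?F" for a x
    proof -
      have "word_functional s ((y * x) * a * z) = 0" for y z
        using that(1) by (simp add: K_def)
      then show ?thesis using that F.m_closed[of x a] by (simp add: K_def mult.assoc)
    qed
    show "a \<otimes>\<^bsub>?F\<^esub> x \<in> K" if "a \<in> K" "x \<in> carrier ?F" for a x
    proof -
      have "word_functional s (y * a * (x * z)) = 0" for y z
        using that(1) by (simp add: K_def)
      then show ?thesis using that F.m_closed[of a x] by (simp add: K_def mult.assoc)
    qed
  qed (rule ring_free_algebra)
  moreover have "grassmann_relations m \<subseteq> K"
  proof
    fix r :: "'a ncpoly"
    assume "r \<in> grassmann_relations m"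
    then consider k where "r = var k * var k" "k \<in> {1..m}"
      | i j where "r = var i * var j + var j * var i" "i \<in> {1..m}" "j \<in> {1..m}"
      unfolding grassmann_relations_def by fastforce
    then have "r \<in> carrier ?F \<and>
      (\<forall>u w c d. word_functional s (Poly_Mapping.single u c * r * Poly_Mapping.single w d) = 0)"
    proof cases
      case 1
      have "s (u + Word [k, k] + w) = 0" for u w
        using alt by (simp add: alternating_def)
      then show ?thesis
        using 1 F.m_closed[of "var k" "var k"]
        by (simp add: var_def mult_single plus_word_def)
    next
      case 2
      have "s (u + Word [i, j] + w) = - s (u + Word [j, i] + w)" for u w
        using alt unfolding alternating_def by blast
      then show ?thesis
        using 2 F.m_closed[of "var i" "var j"] F.m_closed[of "var j" "var i"]
          F.a_closed[of "var i * var j" "var j * var i"]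
        by (simp add: var_def mult_single plus_word_def distrib_left distrib_right
            word_functional_add)
    qed
    then have r: "r \<in> carrier ?F"
      and single: "word_functional s (Poly_Mapping.single u c * r * Poly_Mapping.single w d) = 0"
      for u w c d by blast+
    \<comment> \<open>By linearity the vanishing passes from monomial multipliers to arbitrary ones,
      first on the right and then on the left.\<close>
    have "word_functional s (Poly_Mapping.single u c * r * b) = 0" for u c b
      by (induction b rule: poly_mapping_induct_single)
        (simp_all add: single word_functional_add distrib_left)
    then have "word_functional s (a * r * b) = 0" for a b
      by (induction a rule: poly_mapping_induct_single)
        (simp_all add: word_functional_add distrib_right)
    with r show "r \<in> K" by (simp add: K_def)
  qed
  ultimately have "grassmann_ideal m \<subseteq> K"
    unfolding grassmann_ideal_def by (rule F.genideal_minimal)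
  then have "word_functional s (1 * p * 1) = 0" using p unfolding K_def by blast
  then show ?thesis by simp
qed

section \<open>Two alternating functions on words\<close>

text \<open>For a list without repetitions this is the sign of the permutation that sorts it; a
  repeated entry makes it 0.\<close>

fun list_sign :: "nat list \<Rightarrow> int" where
  "list_sign [] = 1"
| "list_sign (x # xs) = (\<Prod>y\<leftarrow>xs. sgn (int y - int x)) * list_sign xs"

text \<open>Only the factor that compares \<open>i\<close> with \<open>j\<close> changes its sign;
  all other factors are merely reordered.\<close>

lemma list_sign_swap: "list_sign (u @ i # j # w) = - list_sign (u @ j # i # w)"
proof (induction u)
  case Nil
  have "sgn (int i - int j) = - sgn (int j - int i)" by (simp add: sgn_if)
  then show ?case by simp
qed simp

lemma list_sign_sorted: "sorted_wrt (<) xs \<Longrightarrow> list_sign xs = 1"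
proof (induction xs)
  case (Cons x xs)
  then have "map (\<lambda>y. sgn (int y - int x)) xs = map (\<lambda>_. 1) xs"
    by (intro map_cong) auto
  then have "(\<Prod>y\<leftarrow>xs. sgn (int y - int x)) = (\<Prod>y\<leftarrow>xs. 1)" by (simp only:)
  also have "\<dots> = 1" by (induction xs) simp_all
  finally show ?case using Cons by simp
qed simp

lemma alternating_sign: "alternating (\<lambda>w. of_int (list_sign (letters w)))"
  unfolding alternating_def
proof (intro conjI allI)
  fix u w :: "nat word" and i j k :: nat
  \<comment> \<open>Swapping the equal letters gives x = -x, which forces x = 0 in the integers.
    Integer values thus settle characteristic 2 as well.\<close>
  have "list_sign (letters u @ k # k # letters w) = 0"
    using list_sign_swap[of "letters u" k k "letters w"] by simp
  then show "of_int (list_sign (letters (u + Word [k, k] + w))) = 0"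
    by (simp add: plus_word_def)
  show "of_int (list_sign (letters (u + Word [i, j] + w)))
      = - of_int (list_sign (letters (u + Word [j, i] + w)))"
    by (simp add: plus_word_def list_sign_swap[of "letters u" i j "letters w"])
qed

text \<open>The words in both clauses have at least two letters, so the function is 0 on all of
  them.\<close>

lemma alternating_unit: "alternating (\<lambda>w. if w = 0 then 1 else 0)"
  by (simp add: alternating_def plus_word_def zero_word_def)

lemma const_commute: "const c * p = p * (const c :: 'a::comm_ring_1 ncpoly)"
proof (induction p rule: poly_mapping_induct_single)
  case (add p q)
  then show ?case by (simp add: distrib_left distrib_right)
next
  case (single k d)
  then show ?case by (simp add: const_def mult_single mult.commute)
qed simp

section \<open>The quotient map and functionals on the quotient\<close>

context
  fixes m :: nat
begin

lemma grassmann_class_hom: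
  "ring_hom_ring (free_algebra m) (grassmann m :: 'a::comm_ring_1 ncpoly set ring) (grassmann_class m)"
proof -
  have "grassmann_class m = (+>\<^bsub>free_algebra m\<^esub>) (grassmann_ideal m :: 'a ncpoly set)"
    by (simp add: fun_eq_iff grassmann_class_def)
  then show ?thesis
    unfolding grassmann_def using ideal.rcos_ring_hom_ring[OF ideal_grassmann_ideal] by simp
qed

interpretation E: ring_hom_ring
  "free_algebra m" "grassmann m :: 'a::comm_ring_1 ncpoly set ring" "grassmann_class m"
  by (rule grassmann_class_hom)

lemma carrier_grassmann:
  "carrier (grassmann m) = grassmann_class m ` carrier (free_algebra m)"
  unfolding grassmann_def FactRing_def A_RCOSETS_def' grassmann_class_def by auto

lemma grassmann_class_eq_0_iff:
  assumes "p \<in> carrier (free_algebra m)"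
  shows "grassmann_class m p = \<zero>\<^bsub>grassmann m\<^esub> \<longleftrightarrow> p \<in> grassmann_ideal m"
proof -
  have "\<zero>\<^bsub>grassmann m\<^esub> = grassmann_ideal m"
    by (simp add: grassmann_def FactRing_def)
  then show ?thesis
    unfolding grassmann_class_def
    using assms E.R.a_rcos_zero[OF ideal_grassmann_ideal]
      ideal.rcos_const_imp_mem[OF ideal_grassmann_ideal] by auto
qed

lemma grassmann_algebra:
  "algebra_structure (grassmann m :: 'a::comm_ring_1 ncpoly set ring) (grassmann_scalar m)"
proof (intro algebra_structure.intro algebra_structure_axioms.intro ring_grassmann)
  fix a b :: 'a
  show "grassmann_scalar m a \<in> carrier (grassmann m)"
    by (simp add: grassmann_scalar_def)
  show "grassmann_scalar m (1 :: 'a) = \<one>\<^bsub>grassmann m\<^esub>"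
    using E.hom_one by (simp add: grassmann_scalar_def const_def)
  show "grassmann_scalar m (a + b)
      = grassmann_scalar m a \<oplus>\<^bsub>grassmann m\<^esub> grassmann_scalar m b"
    using E.hom_add[OF const_in_free_algebra const_in_free_algebra, of a b]
    by (simp add: grassmann_scalar_def const_def single_add zero_word_def)
  show "grassmann_scalar m (a * b)
      = grassmann_scalar m a \<otimes>\<^bsub>grassmann m\<^esub> grassmann_scalar m b"
    using E.hom_mult[OF const_in_free_algebra const_in_free_algebra, of a b]
    by (simp add: grassmann_scalar_def const_def mult_single)
next
  fix a :: 'a and x :: "'a ncpoly set"
  assume "x \<in> carrier (grassmann m)"
  then obtain p where p: "p \<in> carrier (free_algebra m)" "x = grassmann_class m p"
    by (auto simp: carrier_grassmann)
  then show "grassmann_scalar m a \<otimes>\<^bsub>grassmann m\<^esub> x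
      = x \<otimes>\<^bsub>grassmann m\<^esub> grassmann_scalar m a"
    using E.hom_mult[OF const_in_free_algebra p(1), of a]
      E.hom_mult[OF p(1) const_in_free_algebra, of a]
    by (simp add: grassmann_scalar_def const_commute)
qed

text \<open>Elements of the quotient are cosets, so the functional is read off a chosen
  representative. For alternating \<open>s\<close> the choice does not matter.\<close>

definition class_functional :: "(nat word \<Rightarrow> 'a) \<Rightarrow> 'a::comm_ring_1 ncpoly set \<Rightarrow> 'a" where
  "class_functional s X = word_functional s (SOME p. p \<in> X)"

lemma class_functional_class:
  assumes "alternating s" "p \<in> carrier (free_algebra m)"
  shows "class_functional s (grassmann_class m p) = word_functional s p"
proof -
  interpret I: ideal "grassmann_ideal m" "free_algebra m :: 'a ncpoly ring"
    by (rule ideal_grassmann_ideal)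
  let ?q = "SOME q. q \<in> grassmann_class m p"
  have "p \<in> grassmann_class m p"
    unfolding grassmann_class_def
    using assms(2) by (rule I.a_rcos_self)
  then have "?q \<in> grassmann_class m p" by (rule someI)
  then obtain i where "i \<in> grassmann_ideal m" "?q = i + p"
    unfolding grassmann_class_def a_r_coset_def' by auto
  then show ?thesis
    unfolding class_functional_def
    by (simp add: word_functional_add word_functional_grassmann_ideal[OF assms(1)])
qed

lemma grassmann_monomial_nonzero:
  "grassmann_class m (Poly_Mapping.single (Word [1..<Suc m]) 1) \<noteq> \<zero>\<^bsub>grassmann m\<^esub>"
proof
  let ?p = "Poly_Mapping.single (Word [1..<Suc m]) 1 :: 'a ncpoly"
  have p: "?p \<in> carrier (free_algebra m)" by (rule single_in_free_algebra) auto
  assume "grassmann_class m ?p = \<zero>\<^bsub>grassmann m\<^esub>"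
  then have "?p \<in> grassmann_ideal m"
    using grassmann_class_eq_0_iff[OF p] by blast
  then have "word_functional (\<lambda>w. of_int (list_sign (letters w))) ?p = 0"
    by (rule word_functional_grassmann_ideal[OF alternating_sign])
  moreover have "list_sign [1..<Suc m] = 1"
    by (rule list_sign_sorted) (simp del: upt_Suc)
  ultimately show False by (simp del: upt_Suc)
qed

end


section \<open>The nilpotent element and the grading\<close>

text \<open>Moving \<open>r\<close> past \<open>q\<close> and then past \<open>p\<close> changes the
  sign twice.\<close>

lemma (in ring) anticommuting_product_commutes:
  assumes "p \<in> carrier R" "q \<in> carrier R" "r \<in> carrier R"
    and "p \<otimes> r = \<ominus> (r \<otimes> p)" "q \<otimes> r = \<ominus> (r \<otimes> q)"
  shows "(p \<otimes> q) \<otimes> r = r \<otimes> (p \<otimes> q)"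
proof -
  have "(p \<otimes> q) \<otimes> r = \<ominus> ((p \<otimes> r) \<otimes> q)"
    using assms(1-3) by (simp add: m_assoc assms(5) r_minus)
  also have "\<dots> = r \<otimes> (p \<otimes> q)"
    using assms(1-3) by (simp add: m_assoc assms(4) l_minus)
  finally show ?thesis .
qed

context
  fixes m :: nat
begin

interpretation E: algebra_structure
  "grassmann m :: 'a::comm_ring_1 ncpoly set ring" "grassmann_scalar m"
  by (rule grassmann_algebra)

interpretation H: ring_hom_ring
  "free_algebra m" "grassmann m :: 'a::comm_ring_1 ncpoly set ring" "grassmann_class m"
  by (rule grassmann_class_hom)

lemma grassmann_class_mult:
  "p \<in> carrier (free_algebra m) \<Longrightarrow> q \<in> carrier (free_algebra m) \<Longrightarrow>
    grassmann_class m p \<otimes>\<^bsub>grassmann m\<^esub> grassmann_class m q = grassmann_class m (p * q)"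
  using H.hom_mult[of p q] by simp

lemma grassmann_class_add:
  "p \<in> carrier (free_algebra m) \<Longrightarrow> q \<in> carrier (free_algebra m) \<Longrightarrow>
    grassmann_class m p \<oplus>\<^bsub>grassmann m\<^esub> grassmann_class m q = grassmann_class m (p + q)"
  using H.hom_add[of p q] by simp

lemma grassmann_class_single_mult:
  assumes "set xs \<subseteq> {1..m}" "set ys \<subseteq> {1..m}"
  shows "grassmann_class m (Poly_Mapping.single (Word xs) 1)
      \<otimes>\<^bsub>grassmann m\<^esub> grassmann_class m (Poly_Mapping.single (Word ys) 1)
    = grassmann_class m (Poly_Mapping.single (Word (xs @ ys)) 1 :: 'a::comm_ring_1 ncpoly)"
  using assms by (simp add: grassmann_class_mult mult_single plus_word_def)

section \<open>Relations among the generators\<close>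

lemma grassmann_gen_closed [simp]:
  "i \<in> {1..m} \<Longrightarrow> grassmann_gen m i \<in> carrier (grassmann m :: 'a::comm_ring_1 ncpoly set ring)"
  unfolding grassmann_gen_def by (intro H.hom_closed var_in_free_algebra)

lemma grassmann_class_relation:
  assumes "r \<in> grassmann_relations m"
  shows "grassmann_class m r = \<zero>\<^bsub>grassmann m\<^esub>"
proof -
  have mult: "p * q \<in> carrier (free_algebra m)"
    if "p \<in> carrier (free_algebra m)" "q \<in> carrier (free_algebra m)" for p q :: "'a ncpoly"
    using H.R.m_closed[OF that] by simp
  have add: "p + q \<in> carrier (free_algebra m)"
    if "p \<in> carrier (free_algebra m)" "q \<in> carrier (free_algebra m)" for p q :: "'a ncpoly"
    using H.R.a_closed[OF that] by simp
  have "(grassmann_relations m :: 'a ncpoly set) \<subseteq> carrier (free_algebra m)"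
    unfolding grassmann_relations_def by (auto intro!: mult add var_in_free_algebra)
  then have "r \<in> carrier (free_algebra m)" "r \<in> grassmann_ideal m"
    using assms H.R.genideal_self[of "grassmann_relations m"] unfolding grassmann_ideal_def by blast+
  then show ?thesis by (simp add: grassmann_class_eq_0_iff)
qed

lemma grassmann_gen_square:
  assumes "i \<in> {1..m}"
  shows "grassmann_gen m i \<otimes>\<^bsub>grassmann m\<^esub> grassmann_gen m i
    = (\<zero>\<^bsub>grassmann m\<^esub> :: 'a::comm_ring_1 ncpoly set)"
proof -
  have "grassmann_class m (var i * var i :: 'a ncpoly) = \<zero>\<^bsub>grassmann m\<^esub>"
    using assms by (intro grassmann_class_relation) (auto simp: grassmann_relations_def)
  then show ?thesis
    unfolding grassmann_gen_def
    by (simp only: grassmann_class_mult var_in_free_algebra[OF assms])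
qed

text \<open>The relations cover i < j; the opposite order follows by symmetry, and for i = j both
  sides are zero because squares vanish.\<close>

lemma grassmann_gen_anticommute:
  assumes i: "i \<in> {1..m}" and j: "j \<in> {1..m}"
  shows "grassmann_gen m i \<otimes>\<^bsub>grassmann m\<^esub> grassmann_gen m j
    = \<ominus>\<^bsub>grassmann m\<^esub> (grassmann_gen m j \<otimes>\<^bsub>grassmann m\<^esub> grassmann_gen m i
      :: 'a::comm_ring_1 ncpoly set)"
proof -
  let ?g = "\<lambda>i. grassmann_gen m i :: 'a ncpoly set"
  have less: "?g i \<otimes>\<^bsub>grassmann m\<^esub> ?g j \<oplus>\<^bsub>grassmann m\<^esub> ?g j \<otimes>\<^bsub>grassmann m\<^esub> ?g i
      = \<zero>\<^bsub>grassmann m\<^esub>"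
    if i: "i \<in> {1..m}" and j: "j \<in> {1..m}" and "i < j" for i j
  proof -
    note var = var_in_free_algebra[OF i] var_in_free_algebra[OF j]
    have "(var i * var j :: 'a ncpoly) \<in> carrier (free_algebra m)"
      "(var j * var i :: 'a ncpoly) \<in> carrier (free_algebra m)"
      using H.R.m_closed[of "var i" "var j"] H.R.m_closed[of "var j" "var i"] var by simp_all
    then have "?g i \<otimes>\<^bsub>grassmann m\<^esub> ?g j \<oplus>\<^bsub>grassmann m\<^esub> ?g j \<otimes>\<^bsub>grassmann m\<^esub> ?g i
        = grassmann_class m (var i * var j + var j * var i)"
      unfolding grassmann_gen_def by (simp only: grassmann_class_mult grassmann_class_add var)
    also have "\<dots> = \<zero>\<^bsub>grassmann m\<^esub>"
      using that by (intro grassmann_class_relation) (auto simp: grassmann_relations_def)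
    finally show ?thesis .
  qed
  have "?g i \<otimes>\<^bsub>grassmann m\<^esub> ?g j \<oplus>\<^bsub>grassmann m\<^esub> ?g j \<otimes>\<^bsub>grassmann m\<^esub> ?g i
      = \<zero>\<^bsub>grassmann m\<^esub>"
  proof (cases i j rule: linorder_cases)
    case greater
    then show ?thesis using less[OF j i] i j by (simp add: E.a_comm)
  qed (use i j less grassmann_gen_square[OF i, where 'a='a] in simp_all)
  then show ?thesis
    using i j by (intro E.minus_equality[symmetric]) simp_all
qed

text \<open>The second case occurs only for odd \<open>m\<close> and \<open>j = (m + 1) div 2\<close>, where the summand is \<open>v\<^sub>m\<close>.\<close>

definition grassmann_summand :: "nat \<Rightarrow> 'a::comm_ring_1 ncpoly set" where
  "grassmann_summand j =
    (if 2 * j \<le> m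
     then grassmann_gen m (2 * j - 1) \<otimes>\<^bsub>grassmann m\<^esub> grassmann_gen m (2 * j)
     else grassmann_gen m (2 * j - 1))"

text \<open>The element v of the theorem as a single sum for both parities; the upper bound of the
  index is \<lceil>m/2\<rceil>.\<close>

definition grassmann_nilpotent :: "'a::comm_ring_1 ncpoly set" where
  "grassmann_nilpotent = (\<Oplus>\<^bsub>grassmann m\<^esub>j\<in>{1..(m + 1) div 2}. grassmann_summand j)"

lemma grassmann_summand_closed [simp]:
  assumes "j \<in> {1..(m + 1) div 2}"
  shows "grassmann_summand j \<in> carrier (grassmann m :: 'a::comm_ring_1 ncpoly set ring)"
proof -
  have "2 * j - 1 \<in> {1..m}" "2 * j \<le> m \<Longrightarrow> 2 * j \<in> {1..m}" using assms by auto
  then show ?thesis unfolding grassmann_summand_def by auto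
qed

lemma grassmann_nilpotent_closed [simp]:
  "grassmann_nilpotent \<in> carrier (grassmann m :: 'a::comm_ring_1 ncpoly set ring)"
  unfolding grassmann_nilpotent_def by (intro E.finsum_closed) (simp add: Pi_iff del: One_nat_def)

text \<open>Here the summand is a product of two generators, and each of them anticommutes with the
  third, also when it equals the third.\<close>

lemma grassmann_summand_gen_commute:
  assumes j: "j \<in> {1..(m + 1) div 2}" "2 * j \<le> m" and k: "k \<in> {1..m}"
  shows "grassmann_summand j \<otimes>\<^bsub>grassmann m\<^esub> grassmann_gen m k
    = (grassmann_gen m k \<otimes>\<^bsub>grassmann m\<^esub> grassmann_summand j :: 'a::comm_ring_1 ncpoly set)"
proof -
  have "2 * j - 1 \<in> {1..m}" "2 * j \<in> {1..m}" using j by auto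
  then show ?thesis
    unfolding grassmann_summand_def using j k
    by (simp only: if_True)
      (intro E.anticommuting_product_commutes grassmann_gen_closed grassmann_gen_anticommute; simp)
qed

lemma grassmann_summand_commute:
  assumes i: "i \<in> {1..(m + 1) div 2}" and j: "j \<in> {1..(m + 1) div 2}"
  shows "grassmann_summand i \<otimes>\<^bsub>grassmann m\<^esub> grassmann_summand j
    = (grassmann_summand j \<otimes>\<^bsub>grassmann m\<^esub> grassmann_summand i :: 'a::comm_ring_1 ncpoly set)"
proof -
  have even: "grassmann_summand i \<otimes>\<^bsub>grassmann m\<^esub> grassmann_summand j
      = (grassmann_summand j \<otimes>\<^bsub>grassmann m\<^esub> grassmann_summand i :: 'a ncpoly set)"
    if i: "i \<in> {1..(m + 1) div 2}" "2 * i \<le> m" and j: "j \<in> {1..(m + 1) div 2}" for i j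
  proof -
    let ?x = "grassmann_summand i :: 'a ncpoly set"
    let ?g = "grassmann_gen m (2 * j - 1) :: 'a ncpoly set" and ?h = "grassmann_gen m (2 * j) :: 'a ncpoly set"
    have x: "?x \<in> carrier (grassmann m)" using i by simp
    have j1: "2 * j - 1 \<in> {1..m}" using j by auto
    note g = grassmann_gen_closed[OF j1] grassmann_summand_gen_commute[OF i j1]
    show ?thesis
    proof (cases "2 * j \<le> m")
      case True
      then have j2: "2 * j \<in> {1..m}" using j by auto
      note h = grassmann_gen_closed[OF j2] grassmann_summand_gen_commute[OF i j2]
      have "?x \<otimes>\<^bsub>grassmann m\<^esub> (?g \<otimes>\<^bsub>grassmann m\<^esub> ?h)
          = ?g \<otimes>\<^bsub>grassmann m\<^esub> (?x \<otimes>\<^bsub>grassmann m\<^esub> ?h)"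
        using x g h(1) by (metis E.m_assoc)
      also have "\<dots> = (?g \<otimes>\<^bsub>grassmann m\<^esub> ?h) \<otimes>\<^bsub>grassmann m\<^esub> ?x"
        using x g(1) h by (metis E.m_assoc)
      finally show ?thesis using True by (simp add: grassmann_summand_def[of j])
    next
      case False
      then show ?thesis using g(2) by (simp add: grassmann_summand_def[of j])
    qed
  qed
  \<comment> \<open>Only the last index can belong to a single generator, so two distinct indices
    include one whose summand is a product of two generators.\<close>
  consider "2 * i \<le> m" | "2 * j \<le> m" | "i = j" using i j by fastforce
  then show ?thesis using even[of i j] even[of j i] i j by cases simp_all
qed

lemma grassmann_summand_square:
  assumes j: "j \<in> {1..(m + 1) div 2}"
  shows "grassmann_summand j \<otimes>\<^bsub>grassmann m\<^esub> grassmann_summand j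
    = (\<zero>\<^bsub>grassmann m\<^esub> :: 'a::comm_ring_1 ncpoly set)"
proof -
  let ?x = "grassmann_summand j :: 'a ncpoly set"
  let ?g = "grassmann_gen m (2 * j - 1) :: 'a ncpoly set" and ?h = "grassmann_gen m (2 * j) :: 'a ncpoly set"
  have j1: "2 * j - 1 \<in> {1..m}" using j by auto
  show ?thesis
  proof (cases "2 * j \<le> m")
    case True
    then have j2: "2 * j \<in> {1..m}" using j by auto
    have closed: "?x \<in> carrier (grassmann m)" "?g \<in> carrier (grassmann m)" "?h \<in> carrier (grassmann m)"
      by (intro grassmann_summand_closed grassmann_gen_closed j j1 j2)+
    have x: "?x = ?g \<otimes>\<^bsub>grassmann m\<^esub> ?h" using True by (simp add: grassmann_summand_def)
    have "?x \<otimes>\<^bsub>grassmann m\<^esub> ?x = (?x \<otimes>\<^bsub>grassmann m\<^esub> ?g) \<otimes>\<^bsub>grassmann m\<^esub> ?h"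
      using closed(2,3) unfolding x by (simp only: E.m_assoc E.m_closed)
    \<comment> \<open>Moving the pair past its own first generator brings two copies of
      \<open>?g\<close> together.\<close>
    also have "\<dots> = (?g \<otimes>\<^bsub>grassmann m\<^esub> ?x) \<otimes>\<^bsub>grassmann m\<^esub> ?h"
      by (simp only: grassmann_summand_gen_commute[OF j True j1])
    also have "\<dots> = ((?g \<otimes>\<^bsub>grassmann m\<^esub> ?g) \<otimes>\<^bsub>grassmann m\<^esub> ?h) \<otimes>\<^bsub>grassmann m\<^esub> ?h"
      using closed(2,3) unfolding x by (simp only: E.m_assoc E.m_closed)
    also have "\<dots> = \<zero>\<^bsub>grassmann m\<^esub>"
      using closed(3) by (simp only: grassmann_gen_square[OF j1] E.l_null)
    finally show ?thesis .
  next
    case False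
    then show ?thesis using grassmann_gen_square[OF j1, where 'a='a] by (simp add: grassmann_summand_def)
  qed
qed

lemma grassmann_nilpotent_power:
  defines "c \<equiv> (m + 1) div 2"
  shows "(grassmann_nilpotent :: 'a::comm_ring_1 ncpoly set) [^]\<^bsub>grassmann m\<^esub> Suc c
      = \<zero>\<^bsub>grassmann m\<^esub>"
    and "(grassmann_nilpotent :: 'a ncpoly set) [^]\<^bsub>grassmann m\<^esub> c
      = grassmann_scalar m (of_nat (fact c))
        \<otimes>\<^bsub>grassmann m\<^esub> grassmann_class m (Poly_Mapping.single (Word [1..<Suc m]) 1)"
proof -
  \<comment> \<open>The product of the first \<open>k\<close> summands is the monomial in the first
    2k generators; the minimum cuts it off at \<open>m\<close>, as the last summand for odd
    \<open>m\<close> has just one letter.\<close>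
  define P where "P k = (grassmann_class m (Poly_Mapping.single (Word [1..<Suc (min (2 * k) m)]) 1)
    :: 'a ncpoly set)" for k
  have P0: "P 0 = \<one>\<^bsub>grassmann m\<^esub>"
    using H.hom_one by (simp add: P_def flip: zero_word_def)
  have PSuc: "P (Suc k) = P k \<otimes>\<^bsub>grassmann m\<^esub> grassmann_summand (Suc k)" if k: "k < c" for k
  proof -
    have gen: "grassmann_gen m i = grassmann_class m (Poly_Mapping.single (Word [i]) 1)" for i
      by (simp add: grassmann_gen_def var_def)
    show ?thesis
    proof (cases "2 * Suc k \<le> m")
      case True
      have "[1..<Suc (min (2 * Suc k) m)] = [1..<Suc (2 * k)] @ [2 * Suc k - 1] @ [2 * Suc k]"
        using True by (simp add: min_def)
      then show ?thesis
        unfolding P_def grassmann_summand_def gen using True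
        by (simp add: grassmann_class_single_mult min_def subset_iff del: upt_Suc append.simps)
    next
      case False
      then have m: "m = Suc (2 * k)" using k unfolding c_def by presburger
      then have min: "min (2 * Suc k) m = m" "min (2 * k) m = 2 * k" by simp_all
      have "[1..<Suc m] = [1..<Suc (2 * k)] @ [2 * Suc k - 1]" using m by simp
      moreover have "set [1..<Suc (2 * k)] \<subseteq> {1..m}" "set [2 * Suc k - 1] \<subseteq> {1..m}"
        using m by auto
      ultimately show ?thesis
        unfolding P_def grassmann_summand_def gen min using False
        by (simp only: if_False grassmann_class_single_mult)
    qed
  qed
  have "min (2 * c) m = m" unfolding c_def by linarith
  then have Pc: "P c = grassmann_class m (Poly_Mapping.single (Word [1..<Suc m]) 1)"
    by (simp only: P_def)
  show "(grassmann_nilpotent :: 'a ncpoly set) [^]\<^bsub>grassmann m\<^esub> Suc c = \<zero>\<^bsub>grassmann m\<^esub>"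
    unfolding grassmann_nilpotent_def c_def[symmetric]
    by (rule E.sum_square_zero_power(1)[of c grassmann_summand P, OF _ _ _ P0 PSuc])
      (simp_all only: c_def grassmann_summand_closed grassmann_summand_square grassmann_summand_commute)
  show "(grassmann_nilpotent :: 'a ncpoly set) [^]\<^bsub>grassmann m\<^esub> c
      = grassmann_scalar m (of_nat (fact c))
        \<otimes>\<^bsub>grassmann m\<^esub> grassmann_class m (Poly_Mapping.single (Word [1..<Suc m]) 1)"
    unfolding grassmann_nilpotent_def c_def[symmetric] Pc[symmetric]
    by (rule E.sum_square_zero_power(2)[of c grassmann_summand P, OF _ _ _ P0 PSuc])
      (simp_all only: c_def grassmann_summand_closed grassmann_summand_square grassmann_summand_commute)
qed

section \<open>Homogeneous elements and decompositions\<close>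

lemma grassmann_degree_closed: "y \<in> grassmann_degree m d \<Longrightarrow> y \<in> carrier (grassmann m)"
  unfolding grassmann_degree_def carrier_grassmann by blast

lemma zero_in_grassmann_degree:
  "(\<zero>\<^bsub>grassmann m\<^esub> :: 'a::comm_ring_1 ncpoly set) \<in> grassmann_degree m d"
proof -
  have "grassmann_class m (0 :: 'a::comm_ring_1 ncpoly) = \<zero>\<^bsub>grassmann m\<^esub>"
    using H.hom_zero by simp
  moreover have "(0 :: 'a ncpoly) \<in> carrier (free_algebra m)" using H.R.zero_closed by simp
  ultimately show ?thesis
    unfolding grassmann_degree_def by (intro image_eqI[of _ _ 0]) simp_all
qed

lemma add_in_grassmann_degree:
  assumes "x \<in> grassmann_degree m d" "y \<in> grassmann_degree m d"
  shows "x \<oplus>\<^bsub>grassmann m\<^esub> y \<in> grassmann_degree m d"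
proof -
  obtain p where p: "p \<in> carrier (free_algebra m)" "x = grassmann_class m p"
    "\<forall>w\<in>Poly_Mapping.keys p. length (letters w) = d"
    using assms(1) unfolding grassmann_degree_def by blast
  obtain q where q: "q \<in> carrier (free_algebra m)" "y = grassmann_class m q"
    "\<forall>w\<in>Poly_Mapping.keys q. length (letters w) = d"
    using assms(2) unfolding grassmann_degree_def by blast
  have "x \<oplus>\<^bsub>grassmann m\<^esub> y = grassmann_class m (p + q)"
    using p q by (simp add: grassmann_class_add)
  moreover have "p + q \<in> carrier (free_algebra m)" using H.R.a_closed[OF p(1) q(1)] by simp
  moreover have "\<forall>w\<in>Poly_Mapping.keys (p + q). length (letters w) = d"
    using p q Poly_Mapping.keys_add[of p q] by blast
  ultimately show ?thesis unfolding grassmann_degree_def by blast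
qed

lemma single_in_grassmann_degree:
  assumes "set xs \<subseteq> {1..m}"
  shows "grassmann_class m (Poly_Mapping.single (Word xs) c) \<in> grassmann_degree m (length xs)"
  unfolding grassmann_degree_def using assms by (intro imageI) simp

lemma grassmann_scalar_in_degree: "grassmann_scalar m c \<in> grassmann_degree m 0"
  using single_in_grassmann_degree[of "[]" c]
  by (simp add: grassmann_scalar_def const_def zero_word_def)

text \<open>The degree is 2 or 1. The bound by \<open>m\<close> serves the existence of a
  decomposition of v, the positivity its vanishing augmentation.\<close>

lemma grassmann_summand_in_degree:
  assumes j: "j \<in> {1..(m + 1) div 2}"
  shows "\<exists>d\<in>{1..m}. (grassmann_summand j :: 'a::comm_ring_1 ncpoly set) \<in> grassmann_degree m d"
proof -
  have eq: "(grassmann_summand j :: 'a ncpoly set)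
      = grassmann_class m (Poly_Mapping.single (Word xs) 1)"
    if "xs = (if 2 * j \<le> m then [2 * j - 1, 2 * j] else [2 * j - 1])" for xs
  proof (cases "2 * j \<le> m")
    case True
    then have "set [2 * j - 1] \<subseteq> {1..m}" "set [2 * j] \<subseteq> {1..m}" using j by auto
    then show ?thesis
      using True that grassmann_class_single_mult[of "[2 * j - 1]" "[2 * j]", where 'a='a]
      by (simp add: grassmann_summand_def grassmann_gen_def var_def)
  qed (use that in \<open>simp add: grassmann_summand_def grassmann_gen_def var_def\<close>)
  let ?xs = "if 2 * j \<le> m then [2 * j - 1, 2 * j] else [2 * j - 1]"
  have "set ?xs \<subseteq> {1..m}" using j by auto
  then have "(grassmann_summand j :: 'a ncpoly set) \<in> grassmann_degree m (length ?xs)"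
    unfolding eq[OF refl] by (rule single_in_grassmann_degree)
  moreover have "1 \<le> m" using j by (cases m) auto
  then have "length ?xs \<in> {1..m}" using j by auto
  ultimately show ?thesis by blast
qed

text \<open>This records only that a decomposition exists, which is then checked for the entries of
  the matrix. Uniqueness in degree 0 comes from the augmentation.\<close>

definition grassmann_graded :: "'a::comm_ring_1 ncpoly set \<Rightarrow> bool" where
  "grassmann_graded y \<longleftrightarrow>
    (\<exists>c. (\<forall>d\<le>m. c d \<in> grassmann_degree m d) \<and> y = (\<Oplus>\<^bsub>grassmann m\<^esub>d\<in>{..m}. c d))"

lemma grassmann_graded_add:
  assumes "grassmann_graded x" "grassmann_graded y"
  shows "grassmann_graded (x \<oplus>\<^bsub>grassmann m\<^esub> y)"
proof -
  obtain a where a: "\<forall>d\<le>m. a d \<in> grassmann_degree m d" "x = (\<Oplus>\<^bsub>grassmann m\<^esub>d\<in>{..m}. a d)"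
    using assms(1) unfolding grassmann_graded_def by blast
  obtain b where b: "\<forall>d\<le>m. b d \<in> grassmann_degree m d" "y = (\<Oplus>\<^bsub>grassmann m\<^esub>d\<in>{..m}. b d)"
    using assms(2) unfolding grassmann_graded_def by blast
  have "x \<oplus>\<^bsub>grassmann m\<^esub> y = (\<Oplus>\<^bsub>grassmann m\<^esub>d\<in>{..m}. a d \<oplus>\<^bsub>grassmann m\<^esub> b d)"
    unfolding a(2) b(2) using a(1) b(1)
    by (intro E.finsum_addf[symmetric]) (auto intro: grassmann_degree_closed)
  with a(1) b(1) show ?thesis
    unfolding grassmann_graded_def
    by (intro exI[of _ "\<lambda>d. a d \<oplus>\<^bsub>grassmann m\<^esub> b d"]) (simp add: add_in_grassmann_degree)
qed

lemma grassmann_graded_degree: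
  assumes y: "y \<in> grassmann_degree m d" and d: "d \<le> m"
  shows "grassmann_graded y"
proof -
  have "(\<Oplus>\<^bsub>grassmann m\<^esub>e\<in>{..m}. if d = e then y else \<zero>\<^bsub>grassmann m\<^esub>) = y"
    using d grassmann_degree_closed[OF y]
      E.finsum_singleton[of d "{..m}" "\<lambda>_. y"] by simp
  then show ?thesis
    unfolding grassmann_graded_def using y
    by (intro exI[of _ "\<lambda>e. if d = e then y else \<zero>\<^bsub>grassmann m\<^esub>"])
      (simp add: zero_in_grassmann_degree)
qed

lemma grassmann_graded_zero:
  "grassmann_graded (\<zero>\<^bsub>grassmann m\<^esub> :: 'a::comm_ring_1 ncpoly set)"
  by (rule grassmann_graded_degree[OF zero_in_grassmann_degree le0])

lemma grassmann_graded_nilpotent: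
  "grassmann_graded (grassmann_nilpotent :: 'a::comm_ring_1 ncpoly set)"
proof -
  let ?x = "grassmann_summand :: nat \<Rightarrow> 'a ncpoly set"
  have "grassmann_graded (\<Oplus>\<^bsub>grassmann m\<^esub>j\<in>J. ?x j)"
    if "finite J" "J \<subseteq> {1..(m + 1) div 2}" for J
    using that
  proof (induction J rule: finite_induct)
    case empty
    then show ?case by (simp add: grassmann_graded_zero)
  next
    case (insert j J)
    then have j: "j \<in> {1..(m + 1) div 2}" and J: "J \<subseteq> {1..(m + 1) div 2}" by auto
    have "(\<Oplus>\<^bsub>grassmann m\<^esub>j\<in>insert j J. ?x j)
        = ?x j \<oplus>\<^bsub>grassmann m\<^esub> (\<Oplus>\<^bsub>grassmann m\<^esub>j\<in>J. ?x j)"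
    proof (rule E.finsum_insert)
      show "?x \<in> J \<rightarrow> carrier (grassmann m)" using J grassmann_summand_closed by blast
    qed (use insert.hyps j in simp_all)
    moreover have "grassmann_graded (?x j)"
      using grassmann_summand_in_degree[OF j, where 'a='a] grassmann_graded_degree by auto
    ultimately show ?case using insert.IH[OF J] by (simp only: grassmann_graded_add)
  qed
  then show ?thesis unfolding grassmann_nilpotent_def by blast
qed

section \<open>The augmentation and the degree zero component\<close>

definition grassmann_augmentation :: "'a::comm_ring_1 ncpoly set \<Rightarrow> 'a" where
  "grassmann_augmentation = class_functional (\<lambda>w. if w = 0 then 1 else 0)"

lemma grassmann_augmentation_class:
  "p \<in> carrier (free_algebra m) \<Longrightarrow>
    grassmann_augmentation (grassmann_class m p) = word_functional (\<lambda>w. if w = 0 then 1 else 0) p"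
  unfolding grassmann_augmentation_def by (rule class_functional_class[OF alternating_unit])

lemma grassmann_augmentation_add:
  assumes "x \<in> carrier (grassmann m)" "y \<in> carrier (grassmann m)"
  shows "grassmann_augmentation (x \<oplus>\<^bsub>grassmann m\<^esub> y)
    = grassmann_augmentation x + grassmann_augmentation y"
proof -
  obtain p q where p: "p \<in> carrier (free_algebra m)" "x = grassmann_class m p"
    and q: "q \<in> carrier (free_algebra m)" "y = grassmann_class m q"
    using assms unfolding carrier_grassmann by blast
  have "p + q \<in> carrier (free_algebra m)" using H.R.a_closed[OF p(1) q(1)] by simp
  then show ?thesis
    using p q
    by (simp add: grassmann_class_add grassmann_augmentation_class word_functional_add)
qed

lemma grassmann_augmentation_zero [simp]: "grassmann_augmentation \<zero>\<^bsub>grassmann m\<^esub> = 0"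
  using grassmann_augmentation_add[OF E.zero_closed E.zero_closed] by simp

lemma grassmann_augmentation_finsum:
  assumes "finite J" "\<And>j. j \<in> J \<Longrightarrow> f j \<in> carrier (grassmann m)"
  shows "grassmann_augmentation (\<Oplus>\<^bsub>grassmann m\<^esub>j\<in>J. f j) = (\<Sum>j\<in>J. grassmann_augmentation (f j))"
  using assms
proof (induction J rule: finite_induct)
  case (insert j J)
  then have "f \<in> J \<rightarrow> carrier (grassmann m)" by auto
  with insert show ?case by (simp add: grassmann_augmentation_add)
qed simp

lemma grassmann_augmentation_scalar [simp]: "grassmann_augmentation (grassmann_scalar m c) = c"
  unfolding grassmann_scalar_def
  by (simp add: grassmann_augmentation_class) (simp add: const_def)

lemma grassmann_augmentation_degree:
  assumes "y \<in> grassmann_degree m d" "d > 0"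
  shows "grassmann_augmentation y = 0"
proof -
  obtain p where p: "p \<in> carrier (free_algebra m)" "y = grassmann_class m p"
    "\<forall>w\<in>Poly_Mapping.keys p. length (letters w) = d"
    using assms(1) unfolding grassmann_degree_def by blast
  have "word_functional (\<lambda>w. if w = 0 then 1 else 0) p = 0"
    unfolding word_functional_def using p(3) assms(2)
    by (intro sum.neutral) (auto simp: zero_word_def)
  then show ?thesis using p by (simp add: grassmann_augmentation_class)
qed

text \<open>The empty word is the only word of length 0, so a homogeneous representative of degree 0
  is a constant, which the augmentation recovers.\<close>

lemma grassmann_degree_0:
  assumes "y \<in> grassmann_degree m 0"
  shows "y = grassmann_scalar m (grassmann_augmentation y)"
proof -
  obtain p where p: "p \<in> carrier (free_algebra m)" "y = grassmann_class m p"
    "\<forall>w\<in>Poly_Mapping.keys p. length (letters w) = 0"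
    using assms unfolding grassmann_degree_def by blast
  have "w = 0" if "w \<in> Poly_Mapping.keys p" for w
    using p(3) that by (cases w) (auto simp: zero_word_def)
  then have "p = const (Poly_Mapping.lookup p 0)"
    by (intro poly_mapping_eqI) (auto simp: const_def lookup_single when_def in_keys_iff)
  then obtain c where "y = grassmann_scalar m c"
    using p(2) unfolding grassmann_scalar_def by metis
  then show ?thesis by simp
qed

text \<open>The augmentation kills the terms of positive degree and determines the term of degree 0.
  Hence \<open>c 0\<close> depends only on the sum.\<close>

lemma grassmann_graded_component_0:
  assumes "\<forall>d\<le>m. c d \<in> grassmann_degree m d"
  shows "c 0 = grassmann_scalar m (grassmann_augmentation (\<Oplus>\<^bsub>grassmann m\<^esub>d\<in>{..m}. c d))"
proof -
  have "grassmann_augmentation (\<Oplus>\<^bsub>grassmann m\<^esub>d\<in>{..m}. c d)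
      = (\<Sum>d\<in>{..m}. grassmann_augmentation (c d))"
    using assms by (intro grassmann_augmentation_finsum) (auto intro: grassmann_degree_closed)
  also have "\<dots> = (\<Sum>d\<in>{0}. grassmann_augmentation (c d))"
    using assms by (intro sum.mono_neutral_right) (auto intro: grassmann_augmentation_degree)
  finally show ?thesis using assms grassmann_degree_0[of "c 0"] by simp
qed

lemma grassmann_augmentation_nilpotent:
  "grassmann_augmentation (grassmann_nilpotent :: 'a::comm_ring_1 ncpoly set) = 0"
proof -
  have "grassmann_augmentation (grassmann_summand j :: 'a ncpoly set) = 0"
    if "j \<in> {1..(m + 1) div 2}" for j
    using grassmann_summand_in_degree[OF that, where 'a='a] grassmann_augmentation_degree by fastforce
  then show ?thesis
    unfolding grassmann_nilpotent_def
    by (subst grassmann_augmentation_finsum) (simp_all del: One_nat_def)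
qed

end


section \<open>Diagonal matrices\<close>

context ring
begin

lemma diag_over_closed:
  "(\<And>i. i < n \<Longrightarrow> d i \<in> carrier R) \<Longrightarrow> diag_over R n d \<in> carrier (matrix_ring R n)"
  by (simp add: matrix_ring_def mat_over_def diag_over_def)

text \<open>The additive structure gives meaning to sums of matrices. Products and powers occur
  below for diagonal matrices and are computed there directly.\<close>

lemma abelian_group_matrix_ring: "abelian_group (matrix_ring R n)"
proof (rule abelian_groupI)
  fix A
  assume A: "A \<in> carrier (matrix_ring R n)"
  then show "\<exists>B\<in>carrier (matrix_ring R n). B \<oplus>\<^bsub>matrix_ring R n\<^esub> A = \<zero>\<^bsub>matrix_ring R n\<^esub>"
    by (intro bexI[of _ "mat n n (\<lambda>(i, j). \<ominus> A $$ (i, j))"])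
      (auto simp: matrix_ring_def mat_over_def l_neg)
qed (auto simp: matrix_ring_def mat_over_def a_ac intro!: eq_matI)

lemma matrix_ring_finsum:
  assumes "finite S" "\<And>k. k \<in> S \<Longrightarrow> F k \<in> carrier (matrix_ring R n)"
  shows "(\<Oplus>\<^bsub>matrix_ring R n\<^esub>k\<in>S. F k) = mat n n (\<lambda>(i, j). \<Oplus>k\<in>S. F k $$ (i, j))"
proof -
  interpret M: abelian_group "matrix_ring R n" by (rule abelian_group_matrix_ring)
  show ?thesis
    using assms
  proof (induction S rule: finite_induct)
    case empty
    show ?case unfolding M.finsum_empty by (auto simp: matrix_ring_def)
  next
    case (insert k S)
    have IH: "(\<Oplus>\<^bsub>matrix_ring R n\<^esub>k\<in>S. F k) = mat n n (\<lambda>(i, j). \<Oplus>k\<in>S. F k $$ (i, j))"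
      using insert by blast
    have F: "F \<in> S \<rightarrow> carrier (matrix_ring R n)" "F k \<in> carrier (matrix_ring R n)"
      using insert.prems by auto
    have entry: "F l $$ (i, j) \<in> carrier R" if "l \<in> insert k S" "i < n" "j < n" for l i j
      using insert.prems[OF that(1)] that by (simp add: matrix_ring_def mat_over_def)
    have "(\<Oplus>\<^bsub>matrix_ring R n\<^esub>l\<in>insert k S. F l)
        = F k \<oplus>\<^bsub>matrix_ring R n\<^esub> mat n n (\<lambda>(i, j). \<Oplus>l\<in>S. F l $$ (i, j))"
      unfolding IH[symmetric] using insert.hyps F by (intro M.finsum_insert)
    also have "\<dots> = mat n n (\<lambda>(i, j). \<Oplus>l\<in>insert k S. F l $$ (i, j))"
    proof (rule eq_matI; clarsimp simp: matrix_ring_def)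
      fix i j
      assume "i < n" "j < n"
      then show "F k $$ (i, j) \<oplus> (\<Oplus>l\<in>S. F l $$ (i, j)) = (\<Oplus>l\<in>insert k S. F l $$ (i, j))"
        using insert.hyps entry by (subst finsum_insert) auto
    qed
    finally show ?case .
  qed
qed

lemma diag_over_mult:
  assumes "\<And>i. i < n \<Longrightarrow> d i \<in> carrier R" "\<And>i. i < n \<Longrightarrow> e i \<in> carrier R"
  shows "diag_over R n d \<otimes>\<^bsub>matrix_ring R n\<^esub> diag_over R n e = diag_over R n (\<lambda>i. d i \<otimes> e i)"
proof (rule eq_matI)
  fix i j
  assume "i < dim_row (diag_over R n (\<lambda>i. d i \<otimes> e i))"
    "j < dim_col (diag_over R n (\<lambda>i. d i \<otimes> e i))"
  then have ij: "i < n" "j < n" by (simp_all add: diag_over_def)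
  have "(diag_over R n d \<otimes>\<^bsub>matrix_ring R n\<^esub> diag_over R n e) $$ (i, j)
      = (\<Oplus>k\<in>{..<n}. diag_over R n d $$ (i, k) \<otimes> diag_over R n e $$ (k, j))"
    using ij by (simp add: matrix_ring_def)
  also have "\<dots> = (\<Oplus>k\<in>{..<n}. if i = k then (if k = j then d k \<otimes> e k else \<zero>) else \<zero>)"
    using ij assms by (intro add.finprod_cong') (auto simp: diag_over_def)
  also have "\<dots> = (if i = j then d i \<otimes> e i else \<zero>)"
    using ij assms by (subst finsum_singleton) auto
  finally show "(diag_over R n d \<otimes>\<^bsub>matrix_ring R n\<^esub> diag_over R n e) $$ (i, j)
      = diag_over R n (\<lambda>i. d i \<otimes> e i) $$ (i, j)"
    using ij by (simp add: diag_over_def)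
qed (simp_all add: matrix_ring_def diag_over_def)

lemma diag_over_power:
  assumes "\<And>i. i < n \<Longrightarrow> d i \<in> carrier R"
  shows "diag_over R n d [^]\<^bsub>matrix_ring R n\<^esub> (k :: nat) = diag_over R n (\<lambda>i. d i [^] k)"
proof (induction k)
  case 0
  then show ?case by (simp add: matrix_ring_def)
next
  case (Suc k)
  then show ?case using assms by (simp add: diag_over_mult)
qed

end

text \<open>Powers and scalar multiples of diagonal matrices are formed on the diagonal, and sums
  entrywise. Evaluation at A thus splits into one evaluation for each diagonal entry.\<close>

lemma (in algebra_structure) eval_in_diag_over:
  assumes x: "\<And>i. i < n \<Longrightarrow> x i \<in> carrier S"
  shows "eval_in (matrix_ring S n) (\<lambda>a. diag_over S n (\<lambda>i. \<phi> a)) p (diag_over S n x)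
    = diag_over S n (\<lambda>i. eval_in S \<phi> p (x i))"
proof -
  have "eval_in (matrix_ring S n) (\<lambda>a. diag_over S n (\<lambda>i. \<phi> a)) p (diag_over S n x)
      = (\<Oplus>\<^bsub>matrix_ring S n\<^esub>k\<in>{..degree p}. diag_over S n (\<lambda>i. \<phi> (coeff p k) \<otimes> x i [^] k))"
    unfolding eval_in_def using x by (simp add: diag_over_power diag_over_mult)
  also have "\<dots> = mat n n (\<lambda>(i, j). \<Oplus>k\<in>{..degree p}.
      diag_over S n (\<lambda>i. \<phi> (coeff p k) \<otimes> x i [^] k) $$ (i, j))"
    using x by (intro matrix_ring_finsum diag_over_closed) simp_all
  also have "\<dots> = diag_over S n (\<lambda>i. eval_in S \<phi> p (x i))"
    by (intro eq_matI) (auto simp: diag_over_def eval_in_def)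
  finally show ?thesis .
qed

text \<open>Powers of distinct linear factors are coprime. In terms of multiplicities: the factors
  already split off do not vanish at \<open>l j\<close>, so the whole order of q at
  \<open>l j\<close> lies in the cofactor \<open>r\<close>.\<close>

lemma prod_linear_power_dvd:
  fixes l :: "'i \<Rightarrow> 'a::field"
  assumes "finite I" "inj_on l I" "\<And>i. i \<in> I \<Longrightarrow> [:- l i, 1:] ^ k dvd q"
  shows "(\<Prod>i\<in>I. [:- l i, 1:]) ^ k dvd q"
proof (cases "q = 0")
  case False
  show ?thesis
    using assms
  proof (induction I rule: finite_induct)
    case (insert j I)
    let ?g = "(\<Prod>i\<in>I. [:- l i, 1:]) ^ k"
    obtain r where r: "q = ?g * r" using insert by (auto elim: dvdE)
    have "poly ?g (l j) \<noteq> 0"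
      using insert.hyps insert.prems(1) by (auto simp: poly_prod)
    then have "Polynomial.order (l j) ?g = 0" by (rule order_0I)
    then have "Polynomial.order (l j) q = Polynomial.order (l j) r"
      using False order_mult[of ?g r "l j"] unfolding r by simp
    moreover have "k \<le> Polynomial.order (l j) q"
      using False insert.prems(2)[of j] by (simp add: order_divides)
    ultimately have "[:- l j, 1:] ^ k dvd r" by (simp add: order_divides)
    then have "[:- l j, 1:] ^ k * ?g dvd r * ?g" by (intro mult_dvd_mono) simp_all
    then show ?case
      unfolding r by (simp only: prod.insert[OF insert.hyps] power_mult_distrib mult.commute[of r])
  qed simp
qed simp

lemma char_poly_mat_diag: "char_poly (mat_diag n l) = (\<Prod>i<n. [:- l i, 1:])"
proof -
  have "char_poly (mat_diag n l) = (\<Prod>a\<leftarrow>diag_mat (mat_diag n l). [:- a, 1:])"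
    by (rule char_poly_upper_triangular[of _ n]) (auto simp: mat_diag_def)
  also have "diag_mat (mat_diag n l) = map l [0..<n]"
    by (simp add: diag_mat_def mat_diag_def)
  also have "(\<Prod>a\<leftarrow>map l [0..<n]. [:- a, 1:]) = (\<Prod>i\<leftarrow>[0..<n]. [:- l i, 1:])"
    by (simp add: comp_def)
  also have "\<dots> = (\<Prod>i<n. [:- l i, 1:])"
    by (simp add: prod.distinct_set_conv_list[symmetric] atLeast0LessThan)
  finally show ?thesis .
qed

text \<open>A prime divides c! only if it is at most c.\<close>

lemma of_nat_fact_neq_0:
  assumes "CHAR('a::field) = 0 \<or> (prime CHAR('a) \<and> c < CHAR('a))"
  shows "of_nat (fact c) \<noteq> (0 :: 'a)"
  using assms prime_dvd_fact_iff[of "CHAR('a)" c] by (auto simp: of_nat_eq_0_iff_char_dvd)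

section \<open>The degree zero component of a matrix\<close>

text \<open>Matrix sums are entrywise, so the result for single elements applies to each entry. The
  formula involves only \<open>A\<close>, which gives uniqueness.\<close>

lemma grassmann_decomposition_component_0:
  fixes A :: "'a::comm_ring_1 ncpoly set mat"
  assumes C: "grassmann_decomposition m n A C"
  shows "C 0 = mat n n (\<lambda>(i, j). grassmann_scalar m (grassmann_augmentation (A $$ (i, j))))"
proof (rule eq_matI)
  interpret E: ring "grassmann m :: 'a ncpoly set ring" by (rule ring_grassmann)
  have deg: "C d \<in> mat_over n (grassmann_degree m d)" if "d \<le> m" for d
    using C that by (simp add: grassmann_decomposition_def)
  then have "C d \<in> carrier (matrix_ring (grassmann m) n)" if "d \<le> m" for d
    using that by (auto simp: mat_over_def matrix_ring_def intro: grassmann_degree_closed)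
  then have A: "A = mat n n (\<lambda>(i, j). \<Oplus>\<^bsub>grassmann m\<^esub>d\<in>{..m}. C d $$ (i, j))"
    using C E.matrix_ring_finsum[of "{..m}" C n] unfolding grassmann_decomposition_def by simp
  let ?B = "mat n n (\<lambda>(i, j). grassmann_scalar m (grassmann_augmentation (A $$ (i, j))))"
  show "dim_row (C 0) = dim_row ?B" "dim_col (C 0) = dim_col ?B"
    using deg[of 0] by (auto simp: mat_over_def)
  fix i j
  assume "i < dim_row ?B" "j < dim_col ?B"
  then have ij: "i < n" "j < n" by simp_all
  then have "\<forall>d\<le>m. C d $$ (i, j) \<in> grassmann_degree m d"
    using deg by (auto simp: mat_over_def)
  then have "C 0 $$ (i, j) = grassmann_scalar m
      (grassmann_augmentation (\<Oplus>\<^bsub>grassmann m\<^esub>d\<in>{..m}. C d $$ (i, j)))"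
    by (rule grassmann_graded_component_0)
  then show "C 0 $$ (i, j) = ?B $$ (i, j)" using ij by (simp add: A)
qed

lemma grassmann_decomposition_exists:
  fixes A :: "'a::comm_ring_1 ncpoly set mat"
  assumes A: "A \<in> carrier_mat n n"
    and graded: "\<And>i j. i < n \<Longrightarrow> j < n \<Longrightarrow> grassmann_graded m (A $$ (i, j))"
  shows "\<exists>C. grassmann_decomposition m n A C"
proof -
  interpret E: ring "grassmann m :: 'a ncpoly set ring" by (rule ring_grassmann)
  obtain c where c: "\<And>i j d. i < n \<Longrightarrow> j < n \<Longrightarrow> d \<le> m \<Longrightarrow> c i j d \<in> grassmann_degree m d"
    and sum: "\<And>i j. i < n \<Longrightarrow> j < n \<Longrightarrow> A $$ (i, j) = (\<Oplus>\<^bsub>grassmann m\<^esub>d\<in>{..m}. c i j d)"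
    using graded unfolding grassmann_graded_def by metis
  define C where "C d = mat n n (\<lambda>(i, j). c i j d)" for d
  have "C d \<in> mat_over n (grassmann_degree m d)" if "d \<le> m" for d
    using c that by (simp add: C_def mat_over_def)
  moreover have "C d \<in> carrier (matrix_ring (grassmann m) n)" if "d \<le> m" for d
    using c[OF _ _ that, THEN grassmann_degree_closed] by (simp add: C_def mat_over_def matrix_ring_def)
  then have "(\<Oplus>\<^bsub>matrix_ring (grassmann m) n\<^esub>d\<in>{..m}. C d)
      = mat n n (\<lambda>(i, j). \<Oplus>\<^bsub>grassmann m\<^esub>d\<in>{..m}. C d $$ (i, j))"
    by (intro E.matrix_ring_finsum) simp_all
  then have "A = (\<Oplus>\<^bsub>matrix_ring (grassmann m) n\<^esub>d\<in>{..m}. C d)"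
    using A sum by (auto simp: C_def intro!: eq_matI)
  ultimately show ?thesis unfolding grassmann_decomposition_def by blast
qed

theorem proposition3:
  fixes m n :: nat
    and l :: "nat \<Rightarrow> 'a::field"
    and v :: "'a ncpoly set"
    and A :: "'a ncpoly set mat"
    and A0 :: "'a mat"
    and f :: "'a poly"
  assumes n: "n \<ge> 1"
    and char: "CHAR('a) = 0 \<or> (\<exists>p. prime p \<and> CHAR('a) = p \<and> int p > \<lceil>real m / 2\<rceil>)"
    and distinct: "inj_on l {..<n}"
    and v_even: "even m \<Longrightarrow>
      v = (\<Oplus>\<^bsub>grassmann m\<^esub>j\<in>{1..m div 2}.
            grassmann_gen m (2 * j - 1) \<otimes>\<^bsub>grassmann m\<^esub> grassmann_gen m (2 * j))"
    and v_odd: "odd m \<Longrightarrow>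
      v = (\<Oplus>\<^bsub>grassmann m\<^esub>j\<in>{1..m div 2}.
            grassmann_gen m (2 * j - 1) \<otimes>\<^bsub>grassmann m\<^esub> grassmann_gen m (2 * j))
          \<oplus>\<^bsub>grassmann m\<^esub> grassmann_gen m m"
    and A: "A = diag_over (grassmann m) n (\<lambda>i. grassmann_scalar m (l i) \<oplus>\<^bsub>grassmann m\<^esub> v)"
    and A0: "A0 = mat_diag n l"
    and f: "f = (\<Prod>i<n. [:- l i, 1:])"
  shows "is_grassmann_component m n A 0 (map_mat (grassmann_scalar m) A0) \<and>
    char_poly A0 = f \<and>
    is_min_poly (matrix_ring (grassmann m) n) (grassmann_scalar_mat m n) A
      (f ^ (nat \<lceil>real m / 2\<rceil> + 1))"
proof (intro conjI)
  interpret E: field_algebra_structure "grassmann m :: 'a ncpoly set ring" "grassmann_scalar m"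
    by (intro field_algebra_structure.intro grassmann_algebra)
  define c where "c = (m + 1) div 2"
  \<comment> \<open>The ceiling of the statement becomes the integer quotient that bounds the index
    in \<open>grassmann_nilpotent\<close>.\<close>
  have "\<lceil>real m / 2\<rceil> = int c"
    unfolding c_def by (rule ceiling_unique) linarith+
  then have c: "nat \<lceil>real m / 2\<rceil> + 1 = Suc c" and fact: "of_nat (fact c) \<noteq> (0 :: 'a)"
    using char of_nat_fact_neq_0[of c, where 'a='a] by auto
  \<comment> \<open>For indices up to \<open>m div 2\<close> every summand is a product of two
    generators, so this part of v is the same for both parities.\<close>
  have half: "(\<Oplus>\<^bsub>grassmann m\<^esub>j\<in>{1..m div 2}.
      grassmann_gen m (2 * j - 1) \<otimes>\<^bsub>grassmann m\<^esub> grassmann_gen m (2 * j))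
    = (\<Oplus>\<^bsub>grassmann m\<^esub>j\<in>{1..m div 2}. grassmann_summand m j :: 'a ncpoly set)"
  proof (rule E.add.finprod_cong')
    have index: "j \<in> {1..(m + 1) div 2}" "2 * j \<le> m" if "j \<in> {1..m div 2}" for j
      using that by auto
    then show "grassmann_summand m
        \<in> {1..m div 2} \<rightarrow> carrier (grassmann m :: 'a ncpoly set ring)"
      using grassmann_summand_closed by fastforce
    show "grassmann_gen m (2 * j - 1) \<otimes>\<^bsub>grassmann m\<^esub> grassmann_gen m (2 * j)
        = (grassmann_summand m j :: 'a ncpoly set)" if "j \<in> {1..m div 2}" for j
      using index[OF that] by (simp add: grassmann_summand_def)
  qed simp
  have v: "v = grassmann_nilpotent m"
  proof (cases "even m")
    case True
    then show ?thesis using v_even unfolding half grassmann_nilpotent_def by simp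
  next
    case False
    \<comment> \<open>For odd \<open>m\<close> there is one more index, and 2 (m div 2 + 1) - 1 = m
      makes its summand the last generator.\<close>
    then have set: "{1..(m + 1) div 2} = insert (Suc (m div 2)) {1..m div 2}"
      and last: "grassmann_summand m (Suc (m div 2)) = (grassmann_gen m m :: 'a ncpoly set)"
      and m: "m \<in> {1..m}"
      by (auto simp: grassmann_summand_def elim!: oddE)
    have "(\<Oplus>\<^bsub>grassmann m\<^esub>j\<in>insert (Suc (m div 2)) {1..m div 2}. grassmann_summand m j)
        = grassmann_summand m (Suc (m div 2))
          \<oplus>\<^bsub>grassmann m\<^esub> (\<Oplus>\<^bsub>grassmann m\<^esub>j\<in>{1..m div 2}. grassmann_summand m j :: 'a ncpoly set)"
    proof (rule E.finsum_insert)
      show "grassmann_summand m \<in> {1..m div 2} \<rightarrow> carrier (grassmann m :: 'a ncpoly set ring)"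
        by (auto intro!: grassmann_summand_closed)
      show "grassmann_summand m (Suc (m div 2)) \<in> carrier (grassmann m :: 'a ncpoly set ring)"
        unfolding last by (rule grassmann_gen_closed[OF m])
    qed simp_all
    moreover have "(\<Oplus>\<^bsub>grassmann m\<^esub>j\<in>{1..m div 2}. grassmann_summand m j :: 'a ncpoly set) \<in> carrier (grassmann m)"
      by (intro E.finsum_closed) (auto intro!: grassmann_summand_closed)
    ultimately show ?thesis
      using v_odd[OF False] grassmann_gen_closed[OF m, where 'a='a]
      unfolding half grassmann_nilpotent_def set last by (simp add: E.a_comm)
  qed
  have v_carrier: "v \<in> carrier (grassmann m)" unfolding v by (rule grassmann_nilpotent_closed)
  have vSuc: "v [^]\<^bsub>grassmann m\<^esub> Suc c = \<zero>\<^bsub>grassmann m\<^esub>"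
    unfolding v c_def by (rule grassmann_nilpotent_power)
  \<comment> \<open>The assumption on the characteristic enters here through \<open>fact\<close>:
    the power is c! times a nonzero monomial, and c! is invertible.\<close>
  have vc: "v [^]\<^bsub>grassmann m\<^esub> c \<noteq> \<zero>\<^bsub>grassmann m\<^esub>"
  proof -
    let ?w = "grassmann_class m (Poly_Mapping.single (Word [1..<Suc m]) 1) :: 'a ncpoly set"
    have "Poly_Mapping.single (Word [1..<Suc m]) 1 \<in> carrier (free_algebra m :: 'a ncpoly ring)"
      by (rule single_in_free_algebra) auto
    then have "?w \<in> carrier (grassmann m)" unfolding carrier_grassmann by (rule imageI)
    moreover have "v [^]\<^bsub>grassmann m\<^esub> c = grassmann_scalar m (of_nat (fact c)) \<otimes>\<^bsub>grassmann m\<^esub> ?w"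
      unfolding v c_def by (rule grassmann_nilpotent_power)
    ultimately show ?thesis
      using fact grassmann_monomial_nonzero[of m, where 'a='a] by (metis E.scalar_mult_eq_0_iff)
  qed

  show "char_poly A0 = f" unfolding A0 f by (rule char_poly_mat_diag)

  have A_carrier: "A \<in> carrier_mat n n" by (simp add: A diag_over_def)
  have A_entry: "A $$ (i, j)
      = (if i = j then grassmann_scalar m (l i) \<oplus>\<^bsub>grassmann m\<^esub> v else \<zero>\<^bsub>grassmann m\<^esub>)"
    if "i < n" "j < n" for i j
    using that by (simp add: A diag_over_def)
  have "\<exists>C. grassmann_decomposition m n A C"
  proof (rule grassmann_decomposition_exists[OF A_carrier])
    have "grassmann_graded m (grassmann_scalar m (l i))" for i
      by (rule grassmann_graded_degree[OF grassmann_scalar_in_degree le0])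
    then show "grassmann_graded m (A $$ (i, j))" if "i < n" "j < n" for i j
      unfolding A_entry[OF that] v
      by (simp add: grassmann_graded_add grassmann_graded_nilpotent grassmann_graded_zero)
  qed
  moreover have "C 0 = map_mat (grassmann_scalar m) A0" if "grassmann_decomposition m n A C" for C
  proof -
    \<comment> \<open>The augmentation of v is zero, so a diagonal entry \<open>l i\<close> plus v
      has augmentation \<open>l i\<close>.\<close>
    have "grassmann_augmentation (A $$ (i, j)) = A0 $$ (i, j)" if "i < n" "j < n" for i j
      using that v_carrier grassmann_augmentation_nilpotent[of m, where 'a='a]
      by (simp add: A_entry A0 mat_diag_def grassmann_augmentation_add grassmann_augmentation_scalar
          grassmann_augmentation_zero flip: v)
    then show ?thesis
      unfolding grassmann_decomposition_component_0[OF that]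
      by (intro eq_matI) (simp_all add: A0 mat_diag_def)
  qed
  ultimately show "is_grassmann_component m n A 0 (map_mat (grassmann_scalar m) A0)"
    unfolding is_grassmann_component_def by blast

  \<comment> \<open>This determines all polynomials that vanish at \<open>A\<close>; both halves of
    minimality are then divisibility statements in the polynomial ring.\<close>
  have eval: "eval_in (matrix_ring (grassmann m) n) (grassmann_scalar_mat m n) q A
      = \<zero>\<^bsub>matrix_ring (grassmann m) n\<^esub> \<longleftrightarrow> (\<forall>i<n. [:- l i, 1:] ^ Suc c dvd q)" for q
  proof -
    let ?x = "\<lambda>i. grassmann_scalar m (l i) \<oplus>\<^bsub>grassmann m\<^esub> v"
    have "grassmann_scalar_mat m n = (\<lambda>a :: 'a. diag_over (grassmann m) n (\<lambda>i. grassmann_scalar m a))"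
      by (simp add: fun_eq_iff grassmann_scalar_mat_def)
    then have "eval_in (matrix_ring (grassmann m) n) (grassmann_scalar_mat m n) q A
        = diag_over (grassmann m) n (\<lambda>i. eval_in (grassmann m) (grassmann_scalar m) q (?x i))"
      unfolding A using v_carrier by (simp add: E.eval_in_diag_over)
    moreover have "diag_over (grassmann m) n d = \<zero>\<^bsub>matrix_ring (grassmann m) n\<^esub>
        \<longleftrightarrow> (\<forall>i<n. d i = (\<zero>\<^bsub>grassmann m\<^esub> :: 'a ncpoly set))" for d
      by (auto simp: diag_over_def matrix_ring_def mat_eq_iff)
    ultimately show ?thesis
      by (simp only: E.eval_in_nilpotent_eq_0_iff[OF v_carrier vSuc vc])
  qed
  show "is_min_poly (matrix_ring (grassmann m) n) (grassmann_scalar_mat m n) A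
      (f ^ (nat \<lceil>real m / 2\<rceil> + 1))"
    unfolding is_min_poly_def c eval
  proof (intro conjI allI impI)
    show "lead_coeff (f ^ Suc c) = 1" unfolding f lead_coeff_power lead_coeff_prod by simp
    show "[:- l i, 1:] ^ Suc c dvd f ^ Suc c" if "i < n" for i
      unfolding f using that by (intro dvd_power_same dvd_prodI) auto
    fix q
    assume q: "lead_coeff q = 1 \<and> (\<forall>i<n. [:- l i, 1:] ^ Suc c dvd q)"
    then have "f ^ Suc c dvd q"
      unfolding f using distinct by (intro prod_linear_power_dvd) auto
    \<comment> \<open>Divisibility bounds the degree only for nonzero \<open>q\<close>, which the
      leading coefficient 1 guarantees.\<close>
    then show "degree (f ^ Suc c) \<le> degree q"
      using q by (intro dvd_imp_degree_le) auto
  qed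
qed

end
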